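(* Let $q$ be a prime and let $X$ be a positive real number with $X<q$. Given any invertible element $a$ in $\mathbb Z/q\mathbb Z$, the number of triples of primes $p_1,p_2,p_3\le X$ such that $p_1(p_2+p_3)\equiv a\pmod q$ is $$\frac{\pi(X)^3}{q}+O\left(q^{3/16+o(1)}X^{57/32}\right).$$
   Context: $\pi(X)$ is the number of primes $p\le X$; triples $(p_1,p_2,p_3)$ are ordered. The error term is understood in the usual sense, with $o(1)$ tending to $0$ as $q\to\infty$, uniformly in the other parameters: for every $\varepsilon>0$ there is a constant $C(\varepsilon)$ depending only on $\varepsilon$ such that the error term is at most $C(\varepsilon)\,q^{3/16+\varepsilon}X^{57/32}$ in absolute value. *)

theory Defs
  imports Complex_Main "HOL-Number_Theory.Number_Theory"
begin

definition primes_upto :: "real \<Rightarrow> nat set" where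
  "primes_upto X = {p. prime p \<and> real p \<le> X}"

definition prime_pi :: "real \<Rightarrow> nat" where
  "prime_pi X = card (primes_upto X)"

text \<open>The residue class \<open>a\<close> modulo \<open>q\<close> is given by an integer representative.\<close>

definition prime_triples :: "nat \<Rightarrow> int \<Rightarrow> real \<Rightarrow> (nat \<times> nat \<times> nat) set" where
  "prime_triples q a X =
     {(p1, p2, p3). p1 \<in> primes_upto X \<and> p2 \<in> primes_upto X \<and> p3 \<in> primes_upto X \<and>
        [int p1 * (int p2 + int p3) = a] (mod int q)}"

lemma finite_primes_upto: "finite (primes_upto X)"
proof (rule finite_subset)
  show "primes_upto X \<subseteq> {..nat \<lfloor>X\<rfloor>}"
    by (auto simp: primes_upto_def le_nat_floor)
qed simp

lemma finite_prime_triples: "finite (prime_triples q a X)"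
proof (rule finite_subset)
  show "prime_triples q a X \<subseteq> primes_upto X \<times> primes_upto X \<times> primes_upto X"
    by (auto simp: prime_triples_def)
qed (simp add: finite_primes_upto)

end

theory Submission
  imports Defs
    "HOL-Analysis.Harmonic_Numbers"
    "HOL-Analysis.Kronecker_Approximation_Theorem"
    "HOL-Library.Discrete_Functions"
    "HOL-Computational_Algebra.Squarefree"
begin

text \<open>
  Write \<open>e(k) = exp (2 \<pi> i k / q)\<close> and let \<open>1/p\<close> denote an inverse modulo \<open>q\<close>. Detecting the condition
  \<open>p2 + p3 = a/p1\<close> by the frequencies \<open>h\<close> modulo \<open>q\<close>, the frequency \<open>0\<close> contributes the main term
  \<open>\<pi>(X)^3/q\<close> and the others contribute \<open>1/q\<close> times the sum of \<open>S(h)^2 K(-a h)\<close>, where \<open>S(h)\<close> is the sum of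
  \<open>e(h p)\<close> and \<open>K(b)\<close> the sum of \<open>e(b/p)\<close> over the primes \<open>p \<le> X\<close>. These primes are distinct modulo \<open>q\<close>, so
  the second moment of \<open>S\<close> over all frequencies is \<open>q \<pi>(X)\<close>, and the error is at most \<open>\<pi>(X)\<close> times the largest
  \<open>|K(b)|\<close> with \<open>b\<close> invertible (\<open>prime_triples_fourier_bound\<close>). It remains to show that \<open>|K(b)|\<close> is at most
  \<open>q^(3/16 + o(1)) X^(25/32)\<close> (\<open>prime_sum_bound\<close>). For \<open>X \<le> q^(4/5)\<close> the theorem is trivial: \<open>p1\<close>
  and \<open>p2\<close> determine \<open>p3\<close>, and \<open>X^2\<close> is smaller than the claimed error.

  Vaughan's identity (\<open>vaughan_identity\<close>) with both parameters equal to \<open>U = X^(5/6) q^(-2/3)\<close> expresses \<open>K(b)\<close>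
  through double sums of two kinds.

  In a sum of type I one variable is at most \<open>U\<close> and the other one runs through an interval with a smooth
  weight. The inner sum is an incomplete Kloosterman sum and is at most \<open>q^(3/4 + o(1))\<close>: completion
  (\<open>cut_expansion\<close>) leads to complete Kloosterman sums, and these are bounded as Kloosterman did
  (\<open>kloosterman_bound\<close>): their fourth moment over all pairs of parameters counts the solutions of an easy
  system of equations, and a sum with an invertible parameter reappears in it \<open>q - 1\<close> times.

  In a sum of type II both variables \<open>m, n\<close> have ranges longer than \<open>U\<close> and arbitrary bounded coefficients. Hoelder's
  inequality (\<open>bilinear_bound\<close>) bounds it by the additive energies of the inverses of the \<open>m\<close> and of the \<open>n\<close>,
  that is, by the numbers of solutions of \<open>1/x1 + 1/x2 = 1/x3 + 1/x4\<close> modulo \<open>q\<close>. For variables up to \<open>K\<close> this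
  number is at most \<open>q^o(1) K^2 (1 + K^(3/2) q^(-1/2))\<close> by an argument of Heath-Brown (\<open>inv_energy_le\<close>):
  a rational approximation of \<open>l/q\<close> turns \<open>1/x + 1/y = l\<close> into a small number of equations
  \<open>(s x - r) (s y - r) = D\<close> in integers, each of which has at most \<open>q^o(1)\<close> solutions by the divisor bound.
  The value of \<open>U\<close> is the one at which the resulting bound is \<open>q^(3/16 + o(1)) X^(25/32)\<close>.

  All factors \<open>q^o(1)\<close> are carried by one parameter \<open>L\<close> that dominates \<open>2 + ln q\<close> and the number of divisors of
  every integer up to \<open>9 q^2\<close>. The final bound contains \<open>L^5\<close>, and \<open>L\<close> can be taken to be a constant times
  \<open>q^(\<epsilon>/5)\<close> (\<open>log_and_divisor_bound\<close>).
\<close>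

section \<open>Additive characters and completion\<close>

definition add_char :: "nat \<Rightarrow> int \<Rightarrow> complex" where
  "add_char q k = cis (2 * pi * real_of_int k / real q)"

lemma add_char_0 [simp]: "add_char q 0 = 1"
  by (simp add: add_char_def)

lemma norm_add_char [simp]: "norm (add_char q k) = 1"
  by (simp add: add_char_def)

lemma add_char_add: "add_char q (k + l) = add_char q k * add_char q l"
  by (simp add: add_char_def cis_mult add_divide_distrib distrib_left)

lemma add_char_uminus: "add_char q (- k) = cnj (add_char q k)"
  by (simp add: add_char_def cis_cnj)

lemma add_char_diff: "add_char q (k - l) = add_char q k * cnj (add_char q l)"
  using add_char_add[of q k "- l"] by (simp add: add_char_uminus)

lemma add_char_mult_modulus:
  assumes "q > 0"
  shows "add_char q (int q * k) = 1"
proof -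
  have "2 * pi * real_of_int (int q * k) / real q = 2 * pi * real_of_int k"
    using assms by simp
  then show ?thesis
    by (simp add: add_char_def cis_multiple_2pi)
qed

lemma add_char_cong:
  assumes "q > 0" "[k = l] (mod int q)"
  shows "add_char q k = add_char q l"
proof -
  obtain d where "l = k + int q * d"
    using assms(2) cong_iff_lin by blast
  then show ?thesis
    using add_char_mult_modulus[OF assms(1)] by (simp add: add_char_add)
qed

lemma add_char_power: "add_char q (int h * k) = add_char q k ^ h"
  by (induction h) (simp_all add: add_char_add distrib_right)

lemma add_char_eq_1_imp_dvd:
  assumes "q > 0" "add_char q k = 1"
  shows "int q dvd k"
proof -
  have "cos (2 * pi * real_of_int k / real q) = 1"
    using assms(2) by (simp add: add_char_def complex_eq_iff)
  then obtain m where "2 * pi * real_of_int k / real q = of_int m * 2 * pi"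
    using cos_one_2pi_int by blast
  then have "real_of_int k = of_int (m * int q)"
    using assms(1) by (simp add: field_simps)
  then show ?thesis
    by (metis dvd_triv_right of_int_eq_iff)
qed

lemma add_char_orthogonality:
  assumes "q > 0"
  shows "(\<Sum>h<q. add_char q (int h * k)) = (if int q dvd k then of_nat q else 0)"
proof (cases "int q dvd k")
  case True
  then obtain d where d: "k = int q * d" by blast
  have "add_char q (int h * k) = 1" for h
    using add_char_mult_modulus[OF assms, of "int h * d"] by (simp add: d mult.left_commute)
  with True show ?thesis by simp
next
  case False
  have "add_char q k ^ q = 1"
    using add_char_mult_modulus[OF assms, of k] by (simp add: add_char_power)
  moreover have "add_char q k \<noteq> 1"
    using False add_char_eq_1_imp_dvd[OF assms] by blast
  ultimately show ?thesis
    using False by (simp add: add_char_power sum_gp_strict)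
qed

lemma jordan_inequality:
  assumes "0 \<le> x" "x \<le> pi / 2"
  shows "2 * x / pi \<le> sin x"
proof -
  have "convex_on {0..pi / 2} (\<lambda>x. - sin x)"
  proof (rule f''_ge0_imp_convex)
    show "convex {0..pi / 2 :: real}" by simp
    show "((\<lambda>x. - sin x) has_real_derivative - cos x) (at x)" for x :: real
      by (auto intro!: derivative_eq_intros)
    show "((\<lambda>x. - cos x) has_real_derivative sin x) (at x)" for x :: real
      by (auto intro!: derivative_eq_intros)
    show "0 \<le> sin x" if "x \<in> {0..pi / 2}" for x :: real
      using that by (intro sin_ge_zero) auto
  qed
  from convex_onD[OF this, of "2 * x / pi" 0 "pi / 2"] assms show ?thesis
    by (simp add: field_simps)
qed

text \<open>
  The chord between \<open>1\<close> and \<open>e(-h)\<close> has length \<open>2 |sin (\<pi> h/q)|\<close>, and Jordan's inequality compares the sine with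
  the distance from \<open>h/q\<close> to the nearest integer.
\<close>

lemma norm_one_minus_add_char_ge:
  assumes "0 < h" "h < q"
  shows "4 * real (min h (q - h)) / real q \<le> norm (1 - add_char q (- int h))"
proof -
  let ?y = "real (min h (q - h)) / real q"
  have "norm (1 - add_char q (- int h)) = norm (exp (\<i> * of_real (2 * pi * - real h / real q)) - 1)"
    by (simp add: add_char_def cis_conv_exp norm_minus_commute)
  also have "\<dots> = 2 * \<bar>sin ((2 * pi * - real h / real q) / 2)\<bar>"
    by (rule dist_exp_i_1)
  also have "\<dots> = 2 * \<bar>sin (pi * real h / real q)\<bar>"
    by simp
  also have "\<bar>sin (pi * real h / real q)\<bar> = \<bar>sin (pi * ?y)\<bar>"
  proof (cases "h \<le> q - h")
    case False
    have "pi * real (q - h) / real q = pi - pi * real h / real q"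
      using assms by (simp add: field_simps of_nat_diff)
    with False show ?thesis by (simp add: min_def)
  qed (simp add: min_def)
  finally have *: "norm (1 - add_char q (- int h)) = 2 * \<bar>sin (pi * ?y)\<bar>" .
  have "?y \<le> 1 / 2"
    using assms by (auto simp: min_def field_simps)
  then have "pi * ?y \<le> pi / 2"
    using mult_left_mono[of ?y "1/2" pi] by simp
  from jordan_inequality[OF _ this] have "2 * ?y \<le> sin (pi * ?y)"
    by simp
  then have "2 * ?y \<le> \<bar>sin (pi * ?y)\<bar>" by linarith
  with * show ?thesis by simp
qed

text \<open>
  The Fourier coefficients modulo \<open>q\<close> of the indicator function of \<open>{1..Y}\<close>.
\<close>

definition cut_coeff :: "nat \<Rightarrow> nat \<Rightarrow> nat \<Rightarrow> complex" where
  "cut_coeff q Y h = (\<Sum>y = 1..Y. add_char q (- (int h * int y))) / of_nat q"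

text \<open>
  An upper bound for \<open>|cut_coeff q Y h|\<close> that does not depend on \<open>Y\<close>. This uniformity is what allows cutting a
  double sum along the hyperbola \<open>m n \<le> Y\<close>: after the expansion, the end point \<open>Y/m\<close> of the sum over \<open>n\<close> occurs
  only in bounded coefficients depending on \<open>m\<close>.
\<close>

definition cut_weight :: "nat \<Rightarrow> nat \<Rightarrow> real" where
  "cut_weight q h = (if h = 0 then 1 else (1 / real h + 1 / real (q - h)) / 2)"

lemma cut_expansion:
  assumes "n < q" "Y < q"
  shows "(\<Sum>h<q. cut_coeff q Y h * add_char q (int h * int n)) = (if n \<in> {1..Y} then 1 else 0)"
proof -
  have "(\<Sum>h<q. cut_coeff q Y h * add_char q (int h * int n)) =
      (\<Sum>y = 1..Y. \<Sum>h<q. add_char q (int h * (int n - int y))) / of_nat q"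
    unfolding cut_coeff_def sum_divide_distrib sum_distrib_right
    by (subst sum.swap) (simp add: add_char_add[symmetric] algebra_simps)
  also have "\<dots> = (\<Sum>y = 1..Y. if y = n then 1 else 0)"
  proof (subst sum_divide_distrib, intro sum.cong refl)
    fix y assume y: "y \<in> {1..Y}"
    have "int q dvd (int n - int y) \<longleftrightarrow> y = n"
      using assms y dvd_imp_le_int[of "int n - int y" "int q"] by (cases "y = n") auto
    then show "(\<Sum>h<q. add_char q (int h * (int n - int y))) / of_nat q = (if y = n then 1 else 0)"
      using assms by (subst add_char_orthogonality) auto
  qed
  finally show ?thesis by (simp add: sum.delta)
qed

text \<open>
  The coefficient is a geometric sum with ratio \<open>e(-h)\<close>. The sum of the two reciprocals in \<open>cut_weight\<close> stands for
  the reciprocal of the smaller one of \<open>h\<close> and \<open>q - h\<close>.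
\<close>

lemma cut_coeff_bound:
  assumes "h < q" "Y < q"
  shows "norm (cut_coeff q Y h) \<le> cut_weight q h"
proof (cases "h = 0")
  case True
  with assms show ?thesis by (simp add: cut_coeff_def cut_weight_def norm_divide)
next
  case False
  define z where "z = add_char q (- int h)"
  define m where "m = real (min h (q - h))"
  have m: "m > 0" using False assms by (simp add: m_def)
  have lower: "4 * m / real q \<le> norm (1 - z)"
    using norm_one_minus_add_char_ge[of h q] False assms by (simp add: m_def z_def)
  have q: "real q > 0" using assms by simp
  have ne: "z \<noteq> 1" and pos: "norm (1 - z) > 0"
    using lower m q by (auto simp: field_simps)
  have "(\<Sum>y = 1..Y. add_char q (- (int h * int y))) = (\<Sum>y = 1..Y. z ^ y)"
    by (intro sum.cong refl) (simp add: z_def add_char_power[symmetric] mult.commute)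
  also have "\<dots> = z * (1 - z ^ Y) / (1 - z)"
    using ne by (cases "Y = 0") (simp_all add: sum_gp field_simps)
  finally have "norm (\<Sum>y = 1..Y. add_char q (- (int h * int y))) = norm (1 - z ^ Y) / norm (1 - z)"
    by (simp add: norm_divide norm_mult z_def)
  also have "\<dots> \<le> 2 / (4 * m / real q)"
  proof (rule frac_le)
    show "norm (1 - z ^ Y) \<le> 2"
      using norm_triangle_ineq4[of 1 "z ^ Y"] by (simp add: norm_power z_def)
  qed (use lower m q in auto)
  finally have "norm (cut_coeff q Y h) \<le> 1 / m / 2"
    using q m by (simp add: cut_coeff_def norm_divide field_simps)
  also have "1 / m \<le> 1 / real h + 1 / real (q - h)"
    by (auto simp: m_def min_def)
  finally show ?thesis using False by (simp add: cut_weight_def)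
qed

lemma harm_le_ln:
  assumes "n > 0"
  shows "harm n \<le> ln (real n) + 1"
  using assms
proof (induction n rule: nat_induct_non_zero)
  case (Suc n)
  have "ln (1 - 1 / real (Suc n)) \<le> - (1 / real (Suc n))"
    using ln_le_minus_one[of "1 - 1 / real (Suc n)"] Suc by simp
  moreover have "1 - 1 / real (Suc n) = real n / real (Suc n)"
    by (simp add: field_simps)
  ultimately have "inverse (real (Suc n)) \<le> ln (real (Suc n)) - ln (real n)"
    using Suc by (simp add: ln_div inverse_eq_divide)
  with Suc show ?case by (simp add: harm_Suc)
qed (simp add: harm_def)

lemma sum_cut_weight_le:
  assumes "q > 0"
  shows "(\<Sum>h<q. cut_weight q h) \<le> 2 + ln (real q)"
proof -
  have "{..<q} = insert 0 {1..<q}"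
    using assms by auto
  then have "(\<Sum>h<q. cut_weight q h) = cut_weight q 0 + (\<Sum>h = 1..<q. cut_weight q h)"
    by simp
  also have "cut_weight q 0 = 1"
    by (simp add: cut_weight_def)
  also have "(\<Sum>h = 1..<q. cut_weight q h) = (\<Sum>h = 1..<q. 1 / real h / 2) + (\<Sum>h = 1..<q. 1 / real (q - h) / 2)"
    unfolding sum.distrib[symmetric]
    by (intro sum.cong refl) (auto simp: cut_weight_def add_divide_distrib)
  also have "(\<Sum>h = 1..<q. 1 / real (q - h) / 2) = (\<Sum>h = 1..<q. 1 / real h / 2)"
    by (rule sum.reindex_bij_witness[of _ "\<lambda>h. q - h" "\<lambda>h. q - h"]) auto
  also have "(\<Sum>h = 1..<q. 1 / real h / 2) + (\<Sum>h = 1..<q. 1 / real h / 2) = (\<Sum>h = 1..<q. inverse (real h))"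
    unfolding sum.distrib[symmetric] by (intro sum.cong refl) (simp add: field_simps)
  also have "{1..<q} = {1..q - 1}"
    using assms by auto
  also have "(\<Sum>h = 1..q - 1. inverse (real h)) = harm (q - 1)"
    by (simp add: harm_def)
  also have "harm (q - 1) \<le> (harm q :: real)"
    by (intro harm_mono) simp
  also have "harm q \<le> ln (real q) + (1::real)"
    using assms by (rule harm_le_ln)
  finally show ?thesis by simp
qed

text \<open>
  By Fermat's little theorem this power is an inverse of \<open>n\<close> modulo a prime \<open>q\<close>. In this form it is
  multiplicative in \<open>n\<close> as an integer, not only modulo \<open>q\<close>.
\<close>

definition mod_inv :: "nat \<Rightarrow> nat \<Rightarrow> int" where
  "mod_inv q n = int n ^ (q - 2)"

lemma mod_inv_mult: "mod_inv q (m * n) = mod_inv q m * mod_inv q n"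
  by (simp add: mod_inv_def power_mult_distrib)

lemma mod_inv_correct:
  assumes "prime q" "\<not> q dvd n"
  shows "[int n * mod_inv q n = 1] (mod int q)"
proof -
  have "q \<ge> 2" using assms(1) prime_ge_2_nat by blast
  then have "q - 1 = Suc (q - 2)" by simp
  then have "int n * mod_inv q n = int (n ^ (q - 1))"
    by (simp add: mod_inv_def)
  moreover have "[int (n ^ (q - 1)) = int 1] (mod int q)"
    using fermat_theorem[OF assms] cong_int_iff by blast
  ultimately show ?thesis by simp
qed

section \<open>Kloosterman sums\<close>

lemma norm_add_char_sum_square:
  assumes "finite I"
  shows "complex_of_real (norm (\<Sum>i\<in>I. add_char q (f i)) ^ 2) = (\<Sum>(i, j)\<in>I \<times> I. add_char q (f i - f j))"
proof -
  have "complex_of_real (norm (\<Sum>i\<in>I. add_char q (f i)) ^ 2) =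
      (\<Sum>i\<in>I. add_char q (f i)) * cnj (\<Sum>i\<in>I. add_char q (f i))"
    by (rule complex_norm_square)
  also have "\<dots> = (\<Sum>(i, j)\<in>I \<times> I. add_char q (f i - f j))"
    by (simp add: cnj_sum sum_product sum.cartesian_product add_char_diff)
  finally show ?thesis .
qed

text \<open>
  Parseval's identity: opening the square and summing over \<open>h\<close> leaves the pairs with equal residues.
\<close>

lemma add_char_second_moment:
  assumes "q > 0" "finite I"
  shows "(\<Sum>h<q. norm (\<Sum>i\<in>I. add_char q (int h * f i)) ^ 2) =
         real q * card {(i, j). i \<in> I \<and> j \<in> I \<and> [f i = f j] (mod int q)}"
proof -
  let ?A = "{(i, j). i \<in> I \<and> j \<in> I \<and> [f i = f j] (mod int q)}"
  have "complex_of_real (\<Sum>h<q. norm (\<Sum>i\<in>I. add_char q (int h * f i)) ^ 2) =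
      (\<Sum>h<q. \<Sum>(i, j)\<in>I \<times> I. add_char q (int h * (f i - f j)))"
    unfolding of_real_sum norm_add_char_sum_square[OF assms(2)] by (simp add: right_diff_distrib)
  also have "\<dots> = (\<Sum>p\<in>I \<times> I. \<Sum>h<q. add_char q (int h * (f (fst p) - f (snd p))))"
    by (subst sum.swap) (simp add: case_prod_unfold)
  also have "\<dots> = (\<Sum>p\<in>I \<times> I. if p \<in> ?A then of_nat q else 0)"
    using assms(1) by (intro sum.cong refl)
      (auto simp: add_char_orthogonality cong_iff_dvd_diff)
  also have "\<dots> = (\<Sum>p\<in>(I \<times> I) \<inter> ?A. of_nat q)"
    using assms(2) by (subst sum.inter_restrict) auto
  also have "(I \<times> I) \<inter> ?A = ?A"
    by auto
  finally have "complex_of_real (\<Sum>h<q. norm (\<Sum>i\<in>I. add_char q (int h * f i)) ^ 2) =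
      complex_of_real (real q * card ?A)"
    by simp
  then show ?thesis by (simp only: of_real_eq_iff)
qed

lemma add_char_second_moment_2:
  assumes "q > 0" "finite I"
  shows "(\<Sum>(h, k)\<in>{..<q} \<times> {..<q}. norm (\<Sum>i\<in>I. add_char q (int h * f i + int k * g i)) ^ 2) =
         real q ^ 2 * card {(i, j). i \<in> I \<and> j \<in> I \<and> [f i = f j] (mod int q) \<and> [g i = g j] (mod int q)}"
proof -
  let ?A = "{(i, j). i \<in> I \<and> j \<in> I \<and> [f i = f j] (mod int q) \<and> [g i = g j] (mod int q)}"
  have "complex_of_real (\<Sum>(h, k)\<in>{..<q} \<times> {..<q}. norm (\<Sum>i\<in>I. add_char q (int h * f i + int k * g i)) ^ 2) =
      (\<Sum>c\<in>{..<q} \<times> {..<q}. \<Sum>p\<in>I \<times> I.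
        add_char q (int (fst c) * (f (fst p) - f (snd p))) * add_char q (int (snd c) * (g (fst p) - g (snd p))))"
    unfolding of_real_sum case_prod_unfold norm_add_char_sum_square[OF assms(2)]
    by (intro sum.cong refl) (simp add: add_char_add[symmetric] algebra_simps)
  also have "\<dots> = (\<Sum>p\<in>I \<times> I. \<Sum>c\<in>{..<q} \<times> {..<q}.
        add_char q (int (fst c) * (f (fst p) - f (snd p))) * add_char q (int (snd c) * (g (fst p) - g (snd p))))"
    by (rule sum.swap)
  also have "\<dots> = (\<Sum>p\<in>I \<times> I. (\<Sum>h<q. add_char q (int h * (f (fst p) - f (snd p)))) *
      (\<Sum>k<q. add_char q (int k * (g (fst p) - g (snd p)))))"
    by (intro sum.cong refl) (simp add: sum_product sum.cartesian_product case_prod_unfold)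
  also have "\<dots> = (\<Sum>p\<in>I \<times> I. if p \<in> ?A then of_nat q ^ 2 else 0)"
    using assms(1) by (intro sum.cong refl)
      (auto simp: add_char_orthogonality cong_iff_dvd_diff power2_eq_square)
  also have "\<dots> = (\<Sum>p\<in>(I \<times> I) \<inter> ?A. of_nat q ^ 2)"
    using assms(2) by (subst sum.inter_restrict) auto
  also have "(I \<times> I) \<inter> ?A = ?A"
    by auto
  finally have "complex_of_real (\<Sum>(h, k)\<in>{..<q} \<times> {..<q}. norm (\<Sum>i\<in>I. add_char q (int h * f i + int k * g i)) ^ 2) =
      complex_of_real (real q ^ 2 * card ?A)"
    by simp
  then show ?thesis by (simp only: of_real_eq_iff)
qed

text \<open>
  Fourth moments are second moments of sums over pairs, so \<open>add_char_second_moment\<close> applies to them.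
\<close>

lemma norm_add_char_sum_fourth_power:
  assumes "finite I"
  shows "norm (\<Sum>i\<in>I. add_char q (f i)) ^ 4 = norm (\<Sum>s\<in>I \<times> I. add_char q (f (fst s) + f (snd s))) ^ 2"
proof -
  have "(\<Sum>i\<in>I. add_char q (f i)) ^ 2 = (\<Sum>s\<in>I \<times> I. add_char q (f (fst s) + f (snd s)))"
    by (simp add: power2_eq_square sum_product sum.cartesian_product add_char_add case_prod_unfold)
  then show ?thesis
    by (metis norm_power power_mult[of _ 2 2] mult_2 numeral_Bit0)
qed

definition kloosterman :: "nat \<Rightarrow> int \<Rightarrow> int \<Rightarrow> complex" where
  "kloosterman q h b = (\<Sum>x = 1..<q. add_char q (h * int x + b * mod_inv q x))"

lemma kloosterman_cong:
  assumes "q > 0" "[h = h'] (mod int q)" "[b = b'] (mod int q)"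
  shows "kloosterman q h b = kloosterman q h' b'"
  unfolding kloosterman_def
  by (intro sum.cong refl add_char_cong[OF assms(1)] cong_add cong_mult assms cong_refl)

lemma mod_inv_mod:
  "[mod_inv q (n mod q) = mod_inv q n] (mod int q)"
  unfolding mod_inv_def by (intro cong_pow) (simp add: of_nat_mod)

lemma coprime_prime_modulus:
  assumes "prime q" "\<not> int q dvd k"
  shows "coprime k (int q)"
  using prime_imp_coprime[of "int q" k] assms by (simp add: coprime_commute)

lemma bij_betw_mult_mod:
  fixes q c :: nat
  assumes "prime q" "\<not> q dvd c"
  shows "bij_betw (\<lambda>x. c * x mod q) {1..<q} {1..<q}"
proof -
  have q: "q > 0" using prime_gt_0_nat assms by simp
  have cop: "coprime c q"
    using prime_imp_coprime[OF assms] by (simp add: coprime_commute)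
  have inj: "inj_on (\<lambda>x. c * x mod q) {1..<q}"
  proof (rule inj_onI)
    fix x y assume xy: "x \<in> {1..<q}" "y \<in> {1..<q}" "c * x mod q = c * y mod q"
    then have "[c * x = c * y] (mod q)"
      by (simp add: unique_euclidean_semiring_class.cong_def)
    then have "[x = y] (mod q)"
      by (simp only: cong_mult_lcancel_nat[OF cop])
    with xy show "x = y" by (intro cong_less_modulus_unique_nat[of x y q]) auto
  qed
  moreover have "(\<lambda>x. c * x mod q) ` {1..<q} \<subseteq> {1..<q}"
  proof (rule image_subsetI)
    fix x assume x: "x \<in> {1..<q}"
    then have "\<not> q dvd c * x"
      using assms by (auto simp: prime_dvd_mult_iff dest: dvd_imp_le)
    then have "c * x mod q \<noteq> 0" by (simp add: dvd_eq_mod_eq_0)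
    then show "c * x mod q \<in> {1..<q}" using q by auto
  qed
  ultimately show ?thesis
    by (simp add: bij_betw_def endo_inj_surj)
qed

text \<open>
  Multiplication by \<open>c\<close> permutes the invertible residues.
\<close>

lemma kloosterman_scale:
  assumes "prime q" "\<not> q dvd c"
  shows "kloosterman q (h * int c) (b * mod_inv q c) = kloosterman q h b"
proof -
  have q: "q > 0" using prime_gt_0_nat assms by simp
  have "kloosterman q h b = (\<Sum>x = 1..<q. add_char q (h * int (c * x mod q) + b * mod_inv q (c * x mod q)))"
    unfolding kloosterman_def
    by (rule sum.reindex_bij_betw[OF bij_betw_mult_mod[OF assms], symmetric])
  also have "\<dots> = (\<Sum>x = 1..<q. add_char q (h * int (c * x) + b * mod_inv q (c * x)))"
    by (intro sum.cong refl add_char_cong[OF q] cong_add cong_mult cong_refl mod_inv_mod)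
      (simp add: of_nat_mod)
  also have "\<dots> = kloosterman q (h * int c) (b * mod_inv q c)"
    by (simp add: kloosterman_def mod_inv_mult mult.assoc)
  finally show ?thesis ..
qed

lemma mod_inv_not_dvd:
  assumes "prime q" "\<not> q dvd n"
  shows "\<not> int q dvd mod_inv q n"
proof
  assume "int q dvd mod_inv q n"
  then have "int q dvd int n * mod_inv q n" by simp
  with mod_inv_correct[OF assms] have "int q dvd 1"
    using cong_dvd_iff by blast
  with assms(1) show False
    using prime_gt_1_nat[OF assms(1)] by auto
qed

lemma mod_inv_inj:
  assumes "prime q" "m \<in> {1..<q}" "n \<in> {1..<q}" "[mod_inv q m = mod_inv q n] (mod int q)"
  shows "m = n"
proof -
  have nd: "\<not> q dvd m" "\<not> q dvd n" using assms(2,3) by (auto dest: dvd_imp_le)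
  have "[int m = int m * (int n * mod_inv q n)] (mod int q)"
    using cong_scalar_left[OF mod_inv_correct[OF assms(1) nd(2)], of "int m"] by (simp add: cong_sym)
  also have "[int m * (int n * mod_inv q n) = int m * (int n * mod_inv q m)] (mod int q)"
    by (intro cong_scalar_left cong_sym[OF assms(4)])
  also have "int m * (int n * mod_inv q m) = int n * (int m * mod_inv q m)" by simp
  also have "[\<dots> = int n * 1] (mod int q)"
    by (intro cong_scalar_left mod_inv_correct[OF assms(1) nd(1)])
  finally have "[m = n] (mod q)" by (simp add: cong_int_iff)
  with assms(2,3) show ?thesis by (intro cong_less_modulus_unique_nat[of m n q]) auto
qed

text \<open>
  The quadruples counted by the fourth moment of Kloosterman sums.
\<close>

definition kloosterman_solutions :: "nat \<Rightarrow> ((nat \<times> nat) \<times> (nat \<times> nat)) set" where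
  "kloosterman_solutions q = {(s, t). s \<in> {1..<q} \<times> {1..<q} \<and> t \<in> {1..<q} \<times> {1..<q} \<and>
     [int (fst s) + int (snd s) = int (fst t) + int (snd t)] (mod int q) \<and>
     [mod_inv q (fst s) + mod_inv q (snd s) = mod_inv q (fst t) + mod_inv q (snd t)] (mod int q)}"

lemma cong_nat_lt_eq:
  assumes "[int m = int n] (mod int q)" "m < q" "n < q"
  shows "m = n"
  using assms by (intro cong_less_modulus_unique_nat[of m n q]) (simp_all add: cong_int_iff)

text \<open>
  The pairs \<open>(x, y)\<close> and \<open>(z, w)\<close> have the same sum and the same sum of inverses. If the sum is not \<open>0\<close>, dividing
  one by the other shows that they also have the same product, so they are the roots of the same
  quadratic polynomial.
\<close>

lemma kloosterman_solutions_trivial: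
  assumes "prime q" "((x, y), (z, w)) \<in> kloosterman_solutions q" "\<not> int q dvd int x + int y"
  shows "(z, w) = (x, y) \<or> (z, w) = (y, x)"
proof -
  have rng: "x \<in> {1..<q}" "y \<in> {1..<q}" "z \<in> {1..<q}" "w \<in> {1..<q}"
    and c1: "[int x + int y = int z + int w] (mod int q)"
    and c2: "[mod_inv q x + mod_inv q y = mod_inv q z + mod_inv q w] (mod int q)"
    using assms(2) by (auto simp: kloosterman_solutions_def)
  have nd: "\<not> q dvd x" "\<not> q dvd y" "\<not> q dvd z" "\<not> q dvd w"
    using rng by (auto dest: dvd_imp_le)
  have prod: "[int u * int v * (mod_inv q u + mod_inv q v) = int u + int v] (mod int q)"
    if "\<not> q dvd u" "\<not> q dvd v" for u v
  proof -
    have "int u * int v * (mod_inv q u + mod_inv q v) =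
        int v * (int u * mod_inv q u) + int u * (int v * mod_inv q v)"
      by (simp add: algebra_simps)
    also have "[\<dots> = int v * 1 + int u * 1] (mod int q)"
      by (intro cong_add cong_scalar_left mod_inv_correct assms(1) that)
    finally show ?thesis by (simp add: add.commute)
  qed
  let ?k = "mod_inv q x + mod_inv q y"
  have "[int z * int w * ?k = int z * int w * (mod_inv q z + mod_inv q w)] (mod int q)"
    by (intro cong_scalar_left c2)
  also have "[int z * int w * (mod_inv q z + mod_inv q w) = int z + int w] (mod int q)"
    by (rule prod[OF nd(3,4)])
  also have "[int z + int w = int x + int y] (mod int q)" using c1 by (rule cong_sym)
  also have "[int x + int y = int x * int y * ?k] (mod int q)"
    by (rule cong_sym[OF prod[OF nd(1,2)]])
  finally have eq: "[int z * int w * ?k = int x * int y * ?k] (mod int q)" .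
  have "\<not> int q dvd ?k"
  proof
    assume "int q dvd ?k"
    then have "int q dvd int x * int y * ?k" by simp
    then show False using assms(3) cong_dvd_iff[OF prod[OF nd(1,2)]] by blast
  qed
  then have "coprime ?k (int q)"
    by (rule coprime_prime_modulus[OF assms(1)])
  with eq have "[int z * int w = int x * int y] (mod int q)"
    by (simp add: cong_mult_rcancel)
  moreover have "(int z - int x) * (int z - int y) =
      (int x * int y - int z * int w) - int z * ((int x + int y) - (int z + int w))"
    by (simp add: algebra_simps)
  ultimately have "int q dvd (int z - int x) * (int z - int y)"
    using c1 by (simp add: cong_iff_dvd_diff dvd_diff_commute)
  then have "int q dvd int z - int x \<or> int q dvd int z - int y"
    using assms(1) by (simp add: prime_dvd_mult_iff)
  then show ?thesis
  proof
    assume "int q dvd int z - int x"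
    then have zx: "[int z = int x] (mod int q)" by (simp add: cong_iff_dvd_diff)
    then have "z = x" using rng by (intro cong_nat_lt_eq) auto
    moreover from this c1 have "[int x + int w = int x + int y] (mod int q)"
      by (subst cong_sym_eq) simp
    then have "[int w = int y] (mod int q)"
      by (simp add: cong_add_lcancel)
    then have "w = y" using rng by (intro cong_nat_lt_eq) auto
    ultimately show ?thesis by simp
  next
    assume "int q dvd int z - int y"
    then have zx: "[int z = int y] (mod int q)" by (simp add: cong_iff_dvd_diff)
    then have "z = y" using rng by (intro cong_nat_lt_eq) auto
    moreover from this c1 have "[int y + int w = int y + int x] (mod int q)"
      by (subst cong_sym_eq) (simp add: add.commute)
    then have "[int w = int x] (mod int q)"
      by (simp add: cong_add_lcancel)
    then have "w = x" using rng by (intro cong_nat_lt_eq) auto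
    ultimately show ?thesis by simp
  qed
qed

text \<open>
  Besides the solutions with \<open>{z, w} = {x, y}\<close> there are only those with \<open>x + y = 0 = z + w\<close>; each of the three
  families has two free parameters.
\<close>

lemma card_kloosterman_solutions_le:
  assumes "prime q"
  shows "card (kloosterman_solutions q) \<le> 3 * (q - 1) ^ 2"
proof -
  let ?R = "{1..<q} \<times> {1..<q}"
  define A where "A = (\<lambda>(x, y). ((x, y), (x, y))) ` ?R"
  define B where "B = (\<lambda>(x, y). ((x, y), (y, x))) ` ?R"
  define C where "C = (\<lambda>(x, z). ((x, q - x), (z, q - z))) ` ?R"
  have opp: "v = q - u" if "u \<in> {1..<q}" "v \<in> {1..<q}" "int q dvd int u + int v" for u v
  proof -
    have "q dvd u + v" using that(3) by (metis int_dvd_int_iff of_nat_add)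
    then obtain k where k: "u + v = q * k" by blast
    have "k < 2" 
    proof (rule ccontr)
      assume "\<not> k < 2"
      then have "q * 2 \<le> q * k" by (intro mult_le_mono2) simp
      with k that show False by auto
    qed
    moreover have "k \<noteq> 0" using k that by (auto intro!: Nat.gr0I)
    ultimately have "k = 1" by simp
    with k show ?thesis by simp
  qed
  have "kloosterman_solutions q \<subseteq> A \<union> B \<union> C"
  proof
    fix p assume p: "p \<in> kloosterman_solutions q"
    obtain x y z w where xyzw: "p = ((x, y), (z, w))" by (metis surj_pair)
    have rng: "x \<in> {1..<q}" "y \<in> {1..<q}" "z \<in> {1..<q}" "w \<in> {1..<q}"
      and c1: "[int x + int y = int z + int w] (mod int q)"
      using p by (auto simp: kloosterman_solutions_def xyzw)
    show "p \<in> A \<union> B \<union> C"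
    proof (cases "int q dvd int x + int y")
      case True
      moreover from this have "int q dvd int z + int w" using c1 cong_dvd_iff by blast
      ultimately have "y = q - x" "w = q - z" using opp rng by auto
      then have "p = (\<lambda>(x, z). ((x, q - x), (z, q - z))) (x, z)" by (simp add: xyzw)
      then show ?thesis unfolding C_def using rng by blast
    next
      case False
      from kloosterman_solutions_trivial[OF assms p[unfolded xyzw] this] show ?thesis
        unfolding A_def B_def xyzw using rng by auto
    qed
  qed
  then have "card (kloosterman_solutions q) \<le> card (A \<union> B \<union> C)"
    by (intro card_mono) (auto simp: A_def B_def C_def)
  also have "\<dots> \<le> card A + card B + card C"
    by (meson add_le_mono card_Un_le le_refl order_trans)
  also have "\<dots> \<le> card ?R + card ?R + card ?R"
    unfolding A_def B_def C_def by (intro add_mono card_image_le) auto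
  finally show ?thesis by (simp add: power2_eq_square)
qed

lemma kloosterman_fourth_moment:
  assumes "prime q"
  shows "(\<Sum>(h, k)\<in>{..<q} \<times> {..<q}. norm (kloosterman q (int h) (int k)) ^ 4) \<le> 3 * real q ^ 2 * real (q - 1) ^ 2"
proof -
  have q: "q > 0" using prime_gt_0_nat assms by simp
  let ?R = "{1..<q} \<times> {1..<q}"
  have "norm (kloosterman q h k) ^ 4 =
      norm (\<Sum>s\<in>?R. add_char q (h * (int (fst s) + int (snd s)) + k * (mod_inv q (fst s) + mod_inv q (snd s)))) ^ 2" for h k
    unfolding kloosterman_def
    by (subst norm_add_char_sum_fourth_power) (simp_all add: algebra_simps)
  then have "(\<Sum>(h, k)\<in>{..<q} \<times> {..<q}. norm (kloosterman q (int h) (int k)) ^ 4) =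
      real q ^ 2 * card (kloosterman_solutions q)"
    unfolding kloosterman_solutions_def by (simp only:) (subst add_char_second_moment_2[OF q], auto)
  also have "card (kloosterman_solutions q) \<le> 3 * (q - 1) ^ 2"
    by (rule card_kloosterman_solutions_le[OF assms])
  then have "real (card (kloosterman_solutions q)) \<le> real (3 * (q - 1) ^ 2)"
    by (simp only: of_nat_le_iff)
  then have "real q ^ 2 * card (kloosterman_solutions q) \<le> real q ^ 2 * real (3 * (q - 1) ^ 2)"
    by (intro mult_left_mono) auto
  finally show ?thesis by (simp add: mult_ac)
qed

text \<open>
  By \<open>kloosterman_scale\<close> the value at \<open>(h, b)\<close> is attained at the \<open>q - 1\<close> pairs \<open>(h c, b/c)\<close>, which are distinct
  since \<open>b\<close> is invertible. Hence \<open>q - 1\<close> times its fourth power is at most the fourth moment.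
\<close>

lemma kloosterman_bound:
  assumes "prime q" "\<not> int q dvd b"
  shows "norm (kloosterman q h b) \<le> 2 * real q powr (3 / 4)"
proof -
  have q: "q > 1" using prime_gt_1_nat assms by simp
  define g where "g c = (nat ((h * int c) mod int q), nat ((b * mod_inv q c) mod int q))" for c
  have g: "kloosterman q (int (fst (g c))) (int (snd (g c))) = kloosterman q h b" if "c \<in> {1..<q}" for c
  proof -
    have "\<not> q dvd c" using that by (auto dest: dvd_imp_le)
    from kloosterman_scale[OF assms(1) this, of h b] show ?thesis
      using q by (subst (asm) kloosterman_cong[of q "h * int c" "int (fst (g c))" _ "int (snd (g c))"])
        (auto simp: g_def)
  qed
  have inj: "inj_on g {1..<q}"
  proof (rule inj_onI)
    fix c d assume cd: "c \<in> {1..<q}" "d \<in> {1..<q}" "g c = g d"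
    then have "nat ((b * mod_inv q c) mod int q) = nat ((b * mod_inv q d) mod int q)"
      by (simp add: g_def)
    then have "(b * mod_inv q c) mod int q = (b * mod_inv q d) mod int q"
      using q by (subst (asm) eq_nat_nat_iff) auto
    then have "[b * mod_inv q c = b * mod_inv q d] (mod int q)"
      by (simp add: unique_euclidean_semiring_class.cong_def)
    moreover have "coprime b (int q)"
      using assms by (intro coprime_prime_modulus)
    ultimately have "[mod_inv q c = mod_inv q d] (mod int q)"
      by (simp add: cong_mult_lcancel)
    then show "c = d" using mod_inv_inj[OF assms(1)] cd by blast
  qed
  have "real (q - 1) * norm (kloosterman q h b) ^ 4 =
      (\<Sum>c\<in>{1..<q}. norm (kloosterman q (int (fst (g c))) (int (snd (g c)))) ^ 4)"
    by (simp add: g)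
  also have "\<dots> = (\<Sum>p\<in>g ` {1..<q}. norm (kloosterman q (int (fst p)) (int (snd p))) ^ 4)"
    by (subst sum.reindex[OF inj]) (simp add: o_def)
  also have "\<dots> \<le> (\<Sum>(h, k)\<in>{..<q} \<times> {..<q}. norm (kloosterman q (int h) (int k)) ^ 4)"
    unfolding case_prod_unfold using q
    by (intro sum_mono2) (auto simp: g_def nat_less_iff)
  also have "\<dots> \<le> 3 * real q ^ 2 * real (q - 1) ^ 2"
    by (rule kloosterman_fourth_moment[OF assms(1)])
  finally have "real (q - 1) * norm (kloosterman q h b) ^ 4 \<le> real (q - 1) * (3 * real q ^ 2 * real (q - 1))"
    by (simp add: power2_eq_square mult_ac)
  then have "norm (kloosterman q h b) ^ 4 \<le> 3 * real q ^ 2 * real (q - 1)"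
    using q by (subst (asm) mult_le_cancel_left_pos) auto
  also have "\<dots> \<le> 16 * real q ^ 2 * real q"
    by (intro mult_mono) auto
  also have "\<dots> = (2 * real q powr (3 / 4)) ^ 4"
    using q by (simp add: power_mult_distrib powr_power power2_eq_square powr_numeral power3_eq_cube)
  finally show ?thesis
    by (subst (asm) power_mono_iff) auto
qed

text \<open>
  Expanding the indicator function of \<open>{1..Y}\<close> into frequencies gives a combination of complete Kloosterman
  sums whose weights add up to at most \<open>2 + ln q\<close>.
\<close>

lemma incomplete_kloosterman_bound:
  assumes "prime q" "\<not> int q dvd b" "Y < q"
  shows "norm (\<Sum>n = 1..Y. add_char q (b * mod_inv q n)) \<le> 2 * (2 + ln (real q)) * real q powr (3 / 4)"
proof -
  have q: "q > 0" using prime_gt_0_nat assms by simp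
  have "(\<Sum>n = 1..Y. add_char q (b * mod_inv q n)) =
      (\<Sum>n = 1..<q. (if n \<in> {1..Y} then 1 else 0) * add_char q (b * mod_inv q n))"
    using assms(3) by (intro sum.mono_neutral_cong_left) auto
  also have "\<dots> = (\<Sum>n = 1..<q. (\<Sum>h<q. cut_coeff q Y h * add_char q (int h * int n)) * add_char q (b * mod_inv q n))"
    by (intro sum.cong refl) (subst cut_expansion, use assms(3) in auto)
  also have "\<dots> = (\<Sum>h<q. cut_coeff q Y h * kloosterman q (int h) b)"
    unfolding kloosterman_def sum_distrib_left sum_distrib_right
    by (subst sum.swap) (simp add: add_char_add mult_ac)
  also have "norm \<dots> \<le> (\<Sum>h<q. cut_weight q h * (2 * real q powr (3 / 4)))"
  proof (intro sum_norm_le)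
    fix h assume "h \<in> {..<q}"
    then have "norm (cut_coeff q Y h) \<le> cut_weight q h"
      using cut_coeff_bound assms(3) by simp
    moreover have "norm (kloosterman q (int h) b) \<le> 2 * real q powr (3 / 4)"
      by (rule kloosterman_bound[OF assms(1,2)])
    ultimately show "norm (cut_coeff q Y h * kloosterman q (int h) b) \<le> cut_weight q h * (2 * real q powr (3 / 4))"
      unfolding norm_mult by (intro mult_mono) (auto simp: cut_weight_def)
  qed
  also have "\<dots> = (\<Sum>h<q. cut_weight q h) * (2 * real q powr (3 / 4))"
    by (simp add: sum_distrib_right)
  also have "\<dots> \<le> (2 + ln (real q)) * (2 * real q powr (3 / 4))"
    by (intro mult_right_mono sum_cut_weight_le q) auto
  also have "\<dots> = 2 * (2 + ln (real q)) * real q powr (3 / 4)"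
    by simp
  finally show ?thesis .
qed

section \<open>The additive energy of inverses\<close>

definition inv_energy :: "nat \<Rightarrow> nat set \<Rightarrow> nat" where
  "inv_energy q S = card {(s, t). s \<in> S \<times> S \<and> t \<in> S \<times> S \<and>
     [mod_inv q (fst s) + mod_inv q (snd s) = mod_inv q (fst t) + mod_inv q (snd t)] (mod int q)}"

definition inv_sum_reps :: "nat \<Rightarrow> nat set \<Rightarrow> int \<Rightarrow> (nat \<times> nat) set" where
  "inv_sum_reps q S k = {p \<in> S \<times> S. [mod_inv q (fst p) + mod_inv q (snd p) = k] (mod int q)}"

lemma finite_inv_sum_reps [simp]: "finite S \<Longrightarrow> finite (inv_sum_reps q S k)"
  by (simp add: inv_sum_reps_def)

text \<open>
  Since all elements are invertible and smaller than \<open>q\<close>, one variable of a representation determines the other.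
\<close>

lemma inj_on_fst_inv_sum_reps:
  assumes "prime q" "S \<subseteq> {1..<q}"
  shows "inj_on fst (inv_sum_reps q S k)"
proof (rule inj_onI)
  fix p p' assume p: "p \<in> inv_sum_reps q S k" "p' \<in> inv_sum_reps q S k" "fst p = fst p'"
  then have "[mod_inv q (fst p) + mod_inv q (snd p) = mod_inv q (fst p) + mod_inv q (snd p')] (mod int q)"
    by (auto simp: inv_sum_reps_def intro: cong_trans cong_sym)
  then have "[mod_inv q (snd p) = mod_inv q (snd p')] (mod int q)"
    by (simp add: cong_add_lcancel)
  moreover have "snd p \<in> {1..<q}" "snd p' \<in> {1..<q}"
    using p assms(2) by (auto simp: inv_sum_reps_def)
  ultimately have "snd p = snd p'"
    using mod_inv_inj[OF assms(1)] by blast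
  with p(3) show "p = p'" by (simp add: prod_eq_iff)
qed

lemma card_inv_sum_reps_le:
  assumes "prime q" "S \<subseteq> {1..<q}"
  shows "card (inv_sum_reps q S k) \<le> card S"
proof -
  have "finite S" using assms(2) finite_subset by blast
  then show ?thesis
    using inj_on_fst_inv_sum_reps[OF assms]
    by (intro card_inj_on_le[of fst]) (auto simp: inv_sum_reps_def)
qed

lemma card_int_divisors_le:
  assumes "D \<noteq> (0::int)"
  shows "card {d. d dvd D} \<le> 2 * card {d. d dvd nat \<bar>D\<bar>}"
proof -
  let ?P = "{d. d dvd nat \<bar>D\<bar>}"
  have fin: "finite ?P" using assms by (intro finite_divisors_nat) auto
  have "{d. d dvd D} \<subseteq> int ` ?P \<union> (\<lambda>d. - int d) ` ?P"
  proof
    fix d assume "d \<in> {d. d dvd D}"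
    then have "nat \<bar>d\<bar> \<in> ?P" by (simp add: nat_abs_dvd_iff[symmetric] int_dvd_int_iff[symmetric])
    moreover have "d = int (nat \<bar>d\<bar>) \<or> d = - int (nat \<bar>d\<bar>)" by auto
    ultimately show "d \<in> int ` ?P \<union> (\<lambda>d. - int d) ` ?P" by blast
  qed
  then have "card {d. d dvd D} \<le> card (int ` ?P \<union> (\<lambda>d. - int d) ` ?P)"
    using fin by (intro card_mono) auto
  also have "\<dots> \<le> card (int ` ?P) + card ((\<lambda>d. - int d) ` ?P)"
    by (rule card_Un_le)
  also have "\<dots> \<le> card ?P + card ?P"
    using fin by (intro add_mono card_image_le)
  finally show ?thesis by simp
qed

lemma int_abs_le_conv_interval: "{k::int. \<bar>real_of_int k\<bar> \<le> c} = {- \<lfloor>c\<rfloor>..\<lfloor>c\<rfloor>}"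
proof -
  have "\<bar>real_of_int k\<bar> \<le> c \<longleftrightarrow> \<bar>k\<bar> \<le> \<lfloor>c\<rfloor>" for k
    by (simp add: le_floor_iff)
  then have "k \<in> {k::int. \<bar>real_of_int k\<bar> \<le> c} \<longleftrightarrow> k \<in> {- \<lfloor>c\<rfloor>..\<lfloor>c\<rfloor>}" for k
    by (simp add: abs_le_iff minus_le_iff) linarith
  then show ?thesis by blast
qed

lemma card_int_abs_le:
  assumes "c \<ge> 0"
  shows "real (card {k::int. \<bar>real_of_int k\<bar> \<le> c}) \<le> 2 * c + 1"
proof -
  have "real (card {k::int. \<bar>real_of_int k\<bar> \<le> c}) = 2 * real_of_int \<lfloor>c\<rfloor> + 1"
    using assms by (simp add: int_abs_le_conv_interval)
  then show ?thesis using of_int_floor_le[of c] by linarith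
qed

text \<open>
  This is Heath-Brown's argument. Choose \<open>r\<close> and \<open>s\<close> of sizes at most about \<open>sqrt (q K)\<close> and \<open>sqrt (q / K)\<close> with
  \<open>s = r l\<close> modulo \<open>q\<close>. Multiplying \<open>1/x + 1/y = l\<close> by \<open>r x y\<close> gives \<open>s x y - r (x + y) = k q\<close> for an integer \<open>k\<close>
  with \<open>|k| \<le> 4 sqrt (K^3 / q)\<close>, or equivalently \<open>(s x - r) (s y - r) = r^2 + s k q\<close>. For each \<open>k\<close> the right-hand side
  is a fixed nonzero integer of size at most \<open>9 q^2\<close>, and \<open>x\<close> is determined by the divisor \<open>s x - r\<close> of it.
\<close>

lemma card_inv_sum_reps_nonzero_le:
  assumes "prime q" "0 < K" "K < q" "S \<subseteq> {1..K}" "\<not> int q dvd l"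
    and L: "\<And>n. 0 < n \<Longrightarrow> n \<le> 9 * q ^ 2 \<Longrightarrow> real (card {d. d dvd n}) \<le> L"
  shows "real (card (inv_sum_reps q S l)) \<le> 2 * L * (1 + 8 * sqrt (real K ^ 3 / real q))"
proof -
  \<comment> \<open>Dirichlet approximation with denominators up to \<open>\<rho>\<close> balances the two
    contributions to \<open>s x y - r (x + y)\<close>: \<open>|s| K\<close> and \<open>r\<close> are at most \<open>2 \<rho>\<close>.\<close>
  define \<rho> where "\<rho> = sqrt (real q * real K)"
  define N where "N = floor_sqrt (q * K)"
  have q: "q > 0" using prime_gt_0_nat[OF assms(1)] .
  have rho2: "\<rho> ^ 2 = real q * real K" and rho0: "\<rho> > 0"
    using q assms(2) by (simp_all add: \<rho>_def)
  have N0: "N > 0" using q assms(2) by (simp add: N_def)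
  have "real N ^ 2 \<le> \<rho> ^ 2"
    using of_nat_mono[OF floor_sqrt_power2_le[of "q * K"], where ?'a = real] by (simp add: rho2 N_def)
  then have N_le: "real N \<le> \<rho>"
    by (rule power2_le_imp_le) (use rho0 in simp)
  have "q * K < Suc N ^ 2"
    unfolding N_def by (rule Suc_floor_sqrt_power2_gt)
  then have "real (q * K) < real (Suc N ^ 2)" by (rule of_nat_less_iff[THEN iffD2])
  then have "\<rho> ^ 2 < (real N + 1) ^ 2"
    unfolding rho2 by (simp add: add.commute)
  then have "\<rho> < real N + 1"
    by (rule power_less_imp_less_base) simp
  then have N_ge: "\<rho> \<le> 2 * real N"
    using N0 by (simp add: Suc_le_eq[symmetric])
  have "real q * real K < real q ^ 2"
    unfolding power2_eq_square using q assms(3) by simp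
  then have "\<rho> ^ 2 < real q ^ 2"
    by (simp only: rho2)
  then have "\<rho> < real q"
    by (rule power_less_imp_less_base) simp
  with N_le have Nq: "N < q" by linarith
  obtain h r where r: "0 < r" "r \<le> int N" and hr: "\<bar>of_int r * (of_int l / real q) - of_int h\<bar> < 1 / real N"
    using Dirichlet_approx[OF N0] by blast
  define s where "s = r * l - h * int q"
  have "\<bar>real_of_int s\<bar> = real q * \<bar>of_int r * (of_int l / real q) - of_int h\<bar>"
  proof -
    have "real_of_int s = real q * (of_int r * (of_int l / real q) - of_int h)"
      using q by (simp add: s_def field_simps)
    then show ?thesis by (simp add: abs_mult)
  qed
  also have "\<dots> \<le> real q * (1 / real N)"
    using hr by (intro mult_left_mono) auto
  finally have "\<bar>real_of_int s\<bar> * \<rho> \<le> real q / real N * (2 * real N)"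
    using N_ge rho0 by (intro mult_mono) auto
  also have "\<dots> = 2 * real q" using N0 by simp
  finally have "\<bar>real_of_int s\<bar> * \<rho> * real K \<le> 2 * real q * real K"
    by (intro mult_right_mono) auto
  then have "\<bar>real_of_int s\<bar> * real K * \<rho> \<le> 2 * \<rho> * \<rho>"
    using rho2 by (simp add: power2_eq_square mult_ac)
  then have s_le: "\<bar>real_of_int s\<bar> * real K \<le> 2 * \<rho>"
    using rho0 by simp
  have r_le: "real_of_int r \<le> \<rho>"
    using r N_le by linarith
  have pr: "prime (int q)" using assms(1) by simp
  have r_nd: "\<not> int q dvd r"
    using r Nq zdvd_imp_le[of "int q" r] by auto
  have s_nd: "\<not> int q dvd s"
  proof
    assume "int q dvd s"
    then have "int q dvd s + h * int q" by simp
    then have "int q dvd r * l" by (simp add: s_def)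
    with pr r_nd assms(5) show False by (simp add: prime_dvd_mult_iff)
  qed
  then have s0: "s \<noteq> 0" by auto
  have sl: "[s = r * l] (mod int q)" by (simp add: s_def cong_iff_dvd_diff)
  define D where "D k = r ^ 2 + s * k * int q" for k
  define \<kappa> where "\<kappa> = sqrt (real K ^ 3 / real q)"
  have kappa: "\<rho> * real K / real q = \<kappa>"
  proof -
    have "\<rho> * real K / real q = sqrt (real q * real K * real K ^ 2 / real q ^ 2)"
      by (simp add: \<rho>_def real_sqrt_mult real_sqrt_divide)
    also have "real q * real K * real K ^ 2 / real q ^ 2 = real K ^ 3 / real q"
      using q by (simp add: power2_eq_square power3_eq_cube)
    finally show ?thesis by (simp add: \<kappa>_def)
  qed
  define Ks where "Ks = {k::int. \<bar>real_of_int k\<bar> \<le> 4 * \<kappa> \<and> D k \<noteq> 0 \<and> \<bar>D k\<bar> \<le> 9 * int q ^ 2}"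
  have finKs: "finite Ks"
  proof (rule finite_subset)
    show "Ks \<subseteq> {k. \<bar>real_of_int k\<bar> \<le> 4 * \<kappa>}" by (auto simp: Ks_def)
    show "finite {k::int. \<bar>real_of_int k\<bar> \<le> 4 * \<kappa>}"
      by (simp only: int_abs_le_conv_interval) simp
  qed
  have "(\<lambda>p. s * int (fst p) - r) ` inv_sum_reps q S l \<subseteq> (\<Union>k\<in>Ks. {d. d dvd D k})"
  proof
    fix d assume "d \<in> (\<lambda>p. s * int (fst p) - r) ` inv_sum_reps q S l"
    then obtain x y where xy: "(x, y) \<in> inv_sum_reps q S l" and d: "d = s * int x - r"
      by auto
    have rng: "x \<in> {1..K}" "y \<in> {1..K}" and c: "[mod_inv q x + mod_inv q y = l] (mod int q)"
      using xy assms(4) by (auto simp: inv_sum_reps_def)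
    have nd: "\<not> q dvd x" "\<not> q dvd y" using rng assms(3) by (auto dest!: dvd_imp_le)
    note ix = mod_inv_correct[OF assms(1) nd(1)] and iy = mod_inv_correct[OF assms(1) nd(2)]
    have "[l * (int x * int y) = (mod_inv q x + mod_inv q y) * (int x * int y)] (mod int q)"
      by (rule cong_scalar_right[OF cong_sym[OF c]])
    moreover have "(mod_inv q x + mod_inv q y) * (int x * int y) =
        int y * (int x * mod_inv q x) + int x * (int y * mod_inv q y)"
      by (simp add: algebra_simps)
    moreover have "[int y * (int x * mod_inv q x) + int x * (int y * mod_inv q y) = int y * 1 + int x * 1] (mod int q)"
      by (intro cong_add cong_scalar_left ix iy)
    ultimately have lxy: "[l * (int x * int y) = int x + int y] (mod int q)"
      by (metis add.commute cong_trans mult.right_neutral)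
    have "[s * (int x * int y) = r * l * (int x * int y)] (mod int q)"
      by (rule cong_scalar_right[OF sl])
    moreover have "[r * (l * (int x * int y)) = r * (int x + int y)] (mod int q)"
      by (rule cong_scalar_left[OF lxy])
    ultimately have "[s * (int x * int y) = r * (int x + int y)] (mod int q)"
      by (metis cong_trans mult.assoc)
    then obtain k where k: "s * (int x * int y) - r * (int x + int y) = int q * k"
      by (auto simp: cong_iff_dvd_diff)
    have fact: "(s * int x - r) * (s * int y - r) = D k"
    proof -
      have "(s * int x - r) * (s * int y - r) = s * (s * (int x * int y) - r * (int x + int y)) + r ^ 2"
        by (simp add: algebra_simps power2_eq_square)
      then show ?thesis by (simp add: k D_def)
    qed
    have xK: "real x \<le> real K" and yK: "real y \<le> real K" using rng by auto
    have sz: "\<bar>s * int z\<bar> \<le> 2 * \<rho>" if "real z \<le> real K" for z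
    proof -
      have "\<bar>real_of_int (s * int z)\<bar> = \<bar>real_of_int s\<bar> * real z" by (simp add: abs_mult)
      also have "\<dots> \<le> \<bar>real_of_int s\<bar> * real K" using that by (intro mult_left_mono) auto
      finally show ?thesis using s_le by simp
    qed
    have "real q * \<bar>real_of_int k\<bar> = \<bar>real_of_int (s * (int x * int y) - r * (int x + int y))\<bar>"
      by (simp add: k abs_mult)
    also have "\<dots> \<le> \<bar>real_of_int (s * int x)\<bar> * real y + real_of_int r * (real x + real y)"
    proof -
      have "real_of_int (s * (int x * int y) - r * (int x + int y)) =
          real_of_int (s * int x) * real y - real_of_int r * (real x + real y)"
        by simp
      also have "\<bar>\<dots>\<bar> \<le> \<bar>real_of_int (s * int x) * real y\<bar> + \<bar>real_of_int r * (real x + real y)\<bar>"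
        by (rule abs_triangle_ineq4)
      also have "\<dots> = \<bar>real_of_int (s * int x)\<bar> * real y + real_of_int r * (real x + real y)"
        using r by (simp add: abs_mult)
      finally show ?thesis .
    qed
    also have "\<dots> \<le> 2 * \<rho> * real K + \<rho> * (real K + real K)"
      using sz[OF xK] xK yK r_le rho0 r by (intro add_mono mult_mono) auto
    finally have "\<bar>real_of_int k\<bar> \<le> 4 * (\<rho> * real K / real q)"
      using q by (simp add: field_simps)
    then have k1: "\<bar>real_of_int k\<bar> \<le> 4 * \<kappa>" by (simp add: kappa)
    \<comment> \<open>If \<open>s z = r\<close> then \<open>l = 1/z\<close>, which would force \<open>1/w = 0\<close>.\<close>
    have ne: "s * int z - r \<noteq> 0" if z: "\<not> q dvd z" "\<not> q dvd w" "[mod_inv q z + mod_inv q w = l] (mod int q)" for z w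
    proof
      assume "s * int z - r = 0"
      then have "[r * l * int z = r * 1] (mod int q)"
        using cong_scalar_right[OF cong_sym[OF sl], of "int z"] by simp
      then have "[l * int z = 1] (mod int q)"
        by (simp only: mult.assoc cong_mult_lcancel[OF coprime_prime_modulus[OF assms(1) r_nd]])
      moreover have "[(mod_inv q z + mod_inv q w) * int z = l * int z] (mod int q)"
        by (rule cong_scalar_right[OF z(3)])
      ultimately have "[(mod_inv q z + mod_inv q w) * int z = int z * mod_inv q z] (mod int q)"
        using mod_inv_correct[OF assms(1) z(1)] by (metis cong_sym cong_trans)
      then have "int q dvd mod_inv q w * int z"
        by (simp add: cong_iff_dvd_diff algebra_simps)
      then have "int q dvd mod_inv q w \<or> int q dvd int z"
        using pr by (simp add: prime_dvd_mult_iff)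
      then show False
        using mod_inv_not_dvd[OF assms(1) z(2)] z(1) by simp
    qed
    have "s * int x - r \<noteq> 0" "s * int y - r \<noteq> 0"
      using ne[OF nd c] ne[OF nd(2,1)] c by (simp_all add: add.commute)
    then have k2: "D k \<noteq> 0" using fact by auto
    have tri: "\<bar>real_of_int (s * int z - r)\<bar> \<le> 3 * \<rho>" if "real z \<le> real K" for z
      using sz[OF that] r r_le by simp
    have "\<bar>real_of_int (D k)\<bar> = \<bar>real_of_int (s * int x - r)\<bar> * \<bar>real_of_int (s * int y - r)\<bar>"
      by (simp add: fact[symmetric] abs_mult)
    also have "\<dots> \<le> (3 * \<rho>) * (3 * \<rho>)"
      using tri[OF xK] tri[OF yK] rho0 by (intro mult_mono) auto
    also have "\<dots> = 9 * (real q * real K)" by (simp add: rho2[symmetric] power2_eq_square)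
    also have "\<dots> \<le> 9 * (real q * real q)" using assms(3) by (intro mult_left_mono) auto
    also have "\<dots> = real_of_int (9 * int q ^ 2)" by (simp add: power2_eq_square)
    finally have k3: "\<bar>D k\<bar> \<le> 9 * int q ^ 2" by linarith
    have "k \<in> Ks" using k1 k2 k3 by (simp add: Ks_def)
    moreover have "d dvd D k" using fact d by (metis dvd_triv_left)
    ultimately show "d \<in> (\<Union>k\<in>Ks. {d. d dvd D k})" by blast
  qed
  moreover have finD: "finite (\<Union>k\<in>Ks. {d. d dvd D k})"
    using finKs by (auto simp: Ks_def)
  moreover have "inj_on (\<lambda>p. s * int (fst p) - r) (inv_sum_reps q S l)"
  proof -
    have "S \<subseteq> {1..<q}" using assms(3,4) by auto
    from inj_on_fst_inv_sum_reps[OF assms(1) this] show ?thesis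
      using s0 by (simp add: inj_on_def)
  qed
  ultimately have "card (inv_sum_reps q S l) \<le> card (\<Union>k\<in>Ks. {d. d dvd D k})"
    using card_inj_on_le by blast
  also have "\<dots> \<le> (\<Sum>k\<in>Ks. card {d. d dvd D k})"
    by (rule card_UN_le[OF finKs])
  finally have "real (card (inv_sum_reps q S l)) \<le> real (\<Sum>k\<in>Ks. card {d. d dvd D k})"
    by (simp only: of_nat_le_iff)
  also have "\<dots> = (\<Sum>k\<in>Ks. real (card {d. d dvd D k}))" by simp
  also have "\<dots> \<le> (\<Sum>k\<in>Ks. 2 * L)"
  proof (rule sum_mono)
    fix k assume k: "k \<in> Ks"
    then have "real (card {d. d dvd D k}) \<le> 2 * real (card {d. d dvd nat \<bar>D k\<bar>})"
      using card_int_divisors_le[of "D k"] by (simp add: Ks_def)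
    also have "real (card {d. d dvd nat \<bar>D k\<bar>}) \<le> L"
      using k by (intro L) (auto simp: Ks_def nat_le_iff)
    finally show "real (card {d. d dvd D k}) \<le> 2 * L" by simp
  qed
  also have "\<dots> = real (card Ks) * (2 * L)" by simp
  also have "\<dots> \<le> (2 * (4 * \<kappa>) + 1) * (2 * L)"
  proof (rule mult_right_mono)
    have "card Ks \<le> card {k::int. \<bar>real_of_int k\<bar> \<le> 4 * \<kappa>}"
    proof (rule card_mono)
      show "finite {k::int. \<bar>real_of_int k\<bar> \<le> 4 * \<kappa>}"
        by (simp only: int_abs_le_conv_interval) simp
    qed (auto simp: Ks_def)
    then show "real (card Ks) \<le> 2 * (4 * \<kappa>) + 1"
      using card_int_abs_le[of "4 * \<kappa>"] by (simp add: \<kappa>_def)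
    have "0 \<le> real (card {d::nat. d dvd 1})" by simp
    also have "\<dots> \<le> L" using q by (intro L) auto
    finally show "0 \<le> 2 * L" by simp
  qed
  finally show ?thesis by (simp add: \<kappa>_def mult_ac add.commute)
qed

text \<open>
  The energy is the sum over all pairs \<open>(x, y)\<close> of the number of representations of \<open>1/x + 1/y\<close>. The value \<open>0\<close> has
  up to \<open>K\<close> representations, but then it also occurs for at most \<open>K\<close> pairs.
\<close>

lemma inv_energy_le:
  assumes "prime q" "0 < K" "K < q" "S \<subseteq> {1..K}"
    and L: "\<And>n. 0 < n \<Longrightarrow> n \<le> 9 * q ^ 2 \<Longrightarrow> real (card {d. d dvd n}) \<le> L"
  shows "real (inv_energy q S) \<le> 16 * L * real K ^ 2 * (1 + sqrt (real K ^ 3 / real q))"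
proof -
  define \<kappa> where "\<kappa> = sqrt (real K ^ 3 / real q)"
  have k0: "\<kappa> \<ge> 0" by (simp add: \<kappa>_def)
  have q: "q > 0" using prime_gt_0_nat[OF assms(1)] .
  have L1: "1 \<le> L" using L[of 1] q by simp
  have Sq: "S \<subseteq> {1..<q}" using assms(3,4) by auto
  have fin: "finite S" using assms(4) finite_subset by blast
  have cardS: "card S \<le> K" using card_mono[OF _ assms(4)] by simp
  let ?f = "\<lambda>p. mod_inv q (fst p) + mod_inv q (snd p)"
  let ?Z = "inv_sum_reps q S 0"
  have "{(s, t). s \<in> S \<times> S \<and> t \<in> S \<times> S \<and> [?f s = ?f t] (mod int q)} = Sigma (S \<times> S) (\<lambda>s. inv_sum_reps q S (?f s))"
    by (auto simp: inv_sum_reps_def cong_sym_eq)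
  then have "inv_energy q S = (\<Sum>s\<in>S \<times> S. card (inv_sum_reps q S (?f s)))"
    unfolding inv_energy_def using fin by (simp add: card_SigmaI)
  also have "real \<dots> = (\<Sum>s\<in>S \<times> S. real (card (inv_sum_reps q S (?f s))))"
    by simp
  also have "\<dots> \<le> (\<Sum>s\<in>S \<times> S. (if s \<in> ?Z then real K else 0) + 2 * L * (1 + 8 * \<kappa>))"
  proof (rule sum_mono)
    fix s assume s: "s \<in> S \<times> S"
    show "real (card (inv_sum_reps q S (?f s))) \<le> (if s \<in> ?Z then real K else 0) + 2 * L * (1 + 8 * \<kappa>)"
    proof (cases "int q dvd ?f s")
      case True
      with s have "s \<in> ?Z" by (simp add: inv_sum_reps_def cong_0_iff)
      moreover have "card (inv_sum_reps q S (?f s)) \<le> K"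
        using card_inv_sum_reps_le[OF assms(1) Sq] cardS order_trans by blast
      moreover have "0 \<le> 2 * L * (1 + 8 * \<kappa>)" using L1 k0 by simp
      ultimately show ?thesis by simp
    next
      case False
      have "real (card (inv_sum_reps q S (?f s))) \<le> 2 * L * (1 + 8 * \<kappa>)"
        unfolding \<kappa>_def by (rule card_inv_sum_reps_nonzero_le[OF assms(1-4) False L])
      then show ?thesis by simp
    qed
  qed
  also have "\<dots> = (\<Sum>s\<in>S \<times> S. if s \<in> ?Z then real K else 0) + real (card (S \<times> S)) * (2 * L * (1 + 8 * \<kappa>))"
    by (simp only: sum.distrib sum_constant)
  also have "(\<Sum>s\<in>S \<times> S. if s \<in> ?Z then real K else 0) = real (card ?Z) * real K"
  proof -
    have "(\<Sum>s\<in>S \<times> S. if s \<in> ?Z then real K else 0) = (\<Sum>s\<in>(S \<times> S) \<inter> ?Z. real K)"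
      using fin by (subst sum.inter_restrict) auto
    also have "(S \<times> S) \<inter> ?Z = ?Z" by (auto simp: inv_sum_reps_def)
    finally show ?thesis by simp
  qed
  also have "real (card ?Z) * real K + real (card (S \<times> S)) * (2 * L * (1 + 8 * \<kappa>))
      \<le> real K * real K + real K ^ 2 * (2 * L * (1 + 8 * \<kappa>))"
  proof (intro add_mono mult_right_mono)
    show "real (card ?Z) \<le> real K"
      using card_inv_sum_reps_le[OF assms(1) Sq, of 0] cardS by linarith
    show "real (card (S \<times> S)) \<le> real K ^ 2"
      using cardS by (simp add: card_cartesian_product power2_eq_square mult_mono)
  qed (use L1 k0 in auto)
  also have "\<dots> = real K ^ 2 * (1 + 2 * L + 16 * L * \<kappa>)"
    by (simp add: algebra_simps power2_eq_square)
  also have "\<dots> \<le> real K ^ 2 * (16 * L * (1 + \<kappa>))"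
    using L1 k0 by (intro mult_left_mono) (simp_all add: algebra_simps)
  also have "\<dots> = 16 * L * real K ^ 2 * (1 + \<kappa>)"
    by simp
  finally show ?thesis unfolding \<kappa>_def .
qed

section \<open>Bilinear forms in Kloosterman fractions\<close>

lemma card_equal_pairs:
  assumes "finite A"
  shows "card {(x, y). x \<in> A \<and> y \<in> A \<and> g x = g y} = (\<Sum>h\<in>g ` A. card {x \<in> A. g x = h} ^ 2)"
proof -
  have "{(x, y). x \<in> A \<and> y \<in> A \<and> g x = g y} = (\<Union>h\<in>g ` A. {x \<in> A. g x = h} \<times> {x \<in> A. g x = h})"
    by auto
  also have "card \<dots> = (\<Sum>h\<in>g ` A. card ({x \<in> A. g x = h} \<times> {x \<in> A. g x = h}))"
    using assms by (intro card_UN_disjoint) auto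
  finally show ?thesis by (simp add: card_cartesian_product power2_eq_square)
qed

text \<open>
  Moving one term to the other side of each equation exchanges sums and differences.
\<close>

lemma inv_energy_eq_differences:
  assumes "q > 0"
  shows "inv_energy q T = card {(s, t). s \<in> T \<times> T \<and> t \<in> T \<times> T \<and>
     (mod_inv q (fst s) - mod_inv q (snd s)) mod int q = (mod_inv q (fst t) - mod_inv q (snd t)) mod int q}"
  unfolding inv_energy_def
proof (rule bij_betw_same_card[of "\<lambda>((a, b), (c, d)). ((a, d), (c, b))"],
    rule bij_betw_byWitness[of _ "\<lambda>((a, b), (c, d)). ((a, d), (c, b))"])
  have *: "[x + y = z + w] (mod int q) \<longleftrightarrow> (x - w) mod int q = (z - y) mod int q" for x y z w
    unfolding unique_euclidean_semiring_class.cong_def mod_eq_dvd_iff by (simp add: algebra_simps)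
  show "(\<lambda>((a, b), (c, d)). ((a, d), (c, b))) ` {(s, t). s \<in> T \<times> T \<and> t \<in> T \<times> T \<and>
     [mod_inv q (fst s) + mod_inv q (snd s) = mod_inv q (fst t) + mod_inv q (snd t)] (mod int q)}
    \<subseteq> {(s, t). s \<in> T \<times> T \<and> t \<in> T \<times> T \<and>
     (mod_inv q (fst s) - mod_inv q (snd s)) mod int q = (mod_inv q (fst t) - mod_inv q (snd t)) mod int q}"
    by (auto simp: *)
  show "(\<lambda>((a, b), (c, d)). ((a, d), (c, b))) ` {(s, t). s \<in> T \<times> T \<and> t \<in> T \<times> T \<and>
     (mod_inv q (fst s) - mod_inv q (snd s)) mod int q = (mod_inv q (fst t) - mod_inv q (snd t)) mod int q}
    \<subseteq> {(s, t). s \<in> T \<times> T \<and> t \<in> T \<times> T \<and>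
     [mod_inv q (fst s) + mod_inv q (snd s) = mod_inv q (fst t) + mod_inv q (snd t)] (mod int q)}"
    by (auto simp: *)
qed auto

lemma inv_sum_fourth_moment:
  assumes "prime q" "\<not> int q dvd b" "finite S"
  shows "(\<Sum>h<q. norm (\<Sum>m\<in>S. add_char q (int h * (b * mod_inv q m))) ^ 4) = real q * inv_energy q S"
proof -
  have q: "q > 0" using prime_gt_0_nat[OF assms(1)] .
  have "norm (\<Sum>m\<in>S. add_char q (int h * (b * mod_inv q m))) ^ 4 =
      norm (\<Sum>s\<in>S \<times> S. add_char q (int h * (b * (mod_inv q (fst s) + mod_inv q (snd s))))) ^ 2" for h
    by (subst norm_add_char_sum_fourth_power[OF assms(3)]) (simp add: algebra_simps)
  then have "(\<Sum>h<q. norm (\<Sum>m\<in>S. add_char q (int h * (b * mod_inv q m))) ^ 4) =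
      real q * card {(s, t). s \<in> S \<times> S \<and> t \<in> S \<times> S \<and>
        [b * (mod_inv q (fst s) + mod_inv q (snd s)) = b * (mod_inv q (fst t) + mod_inv q (snd t))] (mod int q)}"
    using assms(3) by (simp only:) (subst add_char_second_moment[OF q], auto)
  then show ?thesis
    using coprime_prime_modulus[OF assms(1,2)] by (simp add: inv_energy_def cong_mult_lcancel)
qed

text \<open>
  The Cauchy-Schwarz inequality removes the coefficients of \<open>m\<close> and leaves the sum of \<open>|R(1/n1 - 1/n2)|\<close> over
  pairs \<open>(n1, n2)\<close>, where \<open>R(k)\<close> is the sum of \<open>e(k b/m)\<close>. Let \<open>\<nu>(h)\<close> be the number of pairs with difference \<open>h\<close>.
  Two more applications separate \<open>\<nu>\<close>, whose second moment is the energy of \<open>T\<close>, from \<open>R\<close>, whose fourth moment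
  over all residues is \<open>q\<close> times the energy of \<open>S\<close>.
\<close>

lemma bilinear_bound:
  assumes "prime q" "\<not> int q dvd b" "finite S" "finite T"
    and "\<And>m. m \<in> S \<Longrightarrow> norm (\<alpha> m) \<le> A" "\<And>n. n \<in> T \<Longrightarrow> norm (\<beta> n) \<le> B" "0 \<le> A" "0 \<le> B"
  shows "norm (\<Sum>m\<in>S. \<Sum>n\<in>T. \<alpha> m * \<beta> n * add_char q (b * mod_inv q m * mod_inv q n)) ^ 8 \<le>
     (A * B) ^ 8 * (real (card S) * real (card T)) ^ 4 * (real q * inv_energy q S * inv_energy q T)"
    (is "norm ?W ^ 8 \<le> _")
proof -
  have q: "q > 0" using prime_gt_0_nat[OF assms(1)] .
  define R where "R k = (\<Sum>m\<in>S. add_char q (k * (b * mod_inv q m)))" for k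
  define f where "f m = (\<Sum>n\<in>T. \<beta> n * add_char q (b * mod_inv q m * mod_inv q n))" for m
  define \<delta> where "\<delta> p = mod_inv q (fst p) - mod_inv q (snd p)" for p
  let ?C = "\<Sum>p\<in>T \<times> T. norm (R (\<delta> p))"
  have "?W = (\<Sum>m\<in>S. \<alpha> m * f m)"
    by (simp add: f_def sum_distrib_left mult.assoc)
  then have "norm ?W \<le> (\<Sum>m\<in>S. A * norm (f m))"
    using assms(5) by (auto intro!: sum_norm_le mult_right_mono simp: norm_mult)
  then have "norm ?W ^ 2 \<le> (\<Sum>m\<in>S. A * norm (f m)) ^ 2"
    by (intro power_mono) auto
  also have "\<dots> \<le> (\<Sum>m\<in>S. A ^ 2) * (\<Sum>m\<in>S. norm (f m) ^ 2)"
    by (rule Cauchy_Schwarz_ineq_sum)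
  finally have W2: "norm ?W ^ 2 \<le> real (card S) * A ^ 2 * (\<Sum>m\<in>S. norm (f m) ^ 2)"
    by simp
  have "complex_of_real (\<Sum>m\<in>S. norm (f m) ^ 2) = (\<Sum>m\<in>S. f m * cnj (f m))"
    by (simp only: of_real_sum complex_norm_square)
  also have "\<dots> = (\<Sum>m\<in>S. \<Sum>p\<in>T \<times> T. \<beta> (fst p) * cnj (\<beta> (snd p)) * add_char q (\<delta> p * (b * mod_inv q m)))"
  proof (intro sum.cong refl)
    fix m
    have "f m * cnj (f m) = (\<Sum>p\<in>T \<times> T. (\<beta> (fst p) * add_char q (b * mod_inv q m * mod_inv q (fst p))) *
        cnj (\<beta> (snd p) * add_char q (b * mod_inv q m * mod_inv q (snd p))))"
      by (simp add: f_def sum_product sum.cartesian_product case_prod_unfold cnj_sum)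
    also have "\<dots> = (\<Sum>p\<in>T \<times> T. \<beta> (fst p) * cnj (\<beta> (snd p)) * add_char q (\<delta> p * (b * mod_inv q m)))"
    proof (intro sum.cong refl)
      fix p
      have "\<delta> p * (b * mod_inv q m) = b * mod_inv q m * mod_inv q (fst p) - b * mod_inv q m * mod_inv q (snd p)"
        by (simp add: \<delta>_def algebra_simps)
      then show "(\<beta> (fst p) * add_char q (b * mod_inv q m * mod_inv q (fst p))) *
        cnj (\<beta> (snd p) * add_char q (b * mod_inv q m * mod_inv q (snd p))) =
        \<beta> (fst p) * cnj (\<beta> (snd p)) * add_char q (\<delta> p * (b * mod_inv q m))"
        by (simp add: add_char_diff)
    qed
    finally show "f m * cnj (f m) = (\<Sum>p\<in>T \<times> T. \<beta> (fst p) * cnj (\<beta> (snd p)) * add_char q (\<delta> p * (b * mod_inv q m)))" .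
  qed
  also have "\<dots> = (\<Sum>p\<in>T \<times> T. \<beta> (fst p) * cnj (\<beta> (snd p)) * R (\<delta> p))"
    by (subst sum.swap) (simp add: R_def sum_distrib_left)
  finally have eq: "complex_of_real (\<Sum>m\<in>S. norm (f m) ^ 2) = (\<Sum>p\<in>T \<times> T. \<beta> (fst p) * cnj (\<beta> (snd p)) * R (\<delta> p))" .
  have "(\<Sum>m\<in>S. norm (f m) ^ 2) = norm (complex_of_real (\<Sum>m\<in>S. norm (f m) ^ 2))"
    by (subst norm_of_real) (simp add: sum_nonneg)
  also have "\<dots> \<le> (\<Sum>p\<in>T \<times> T. B ^ 2 * norm (R (\<delta> p)))"
    unfolding eq
  proof (intro sum_norm_le)
    fix p assume "p \<in> T \<times> T"
    then have "norm (\<beta> (fst p)) * norm (\<beta> (snd p)) \<le> B * B"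
      using assms(6,8) by (intro mult_mono) auto
    then show "norm (\<beta> (fst p) * cnj (\<beta> (snd p)) * R (\<delta> p)) \<le> B ^ 2 * norm (R (\<delta> p))"
      by (simp add: norm_mult power2_eq_square mult_right_mono)
  qed
  also have "\<dots> = B ^ 2 * ?C" by (simp add: sum_distrib_left)
  finally have "norm ?W ^ 2 \<le> real (card S) * A ^ 2 * (B ^ 2 * ?C)"
    using W2 by (meson mult_left_mono order_trans mult_nonneg_nonneg of_nat_0_le_iff zero_le_power2)
  then have "(norm ?W ^ 2) ^ 4 \<le> (real (card S) * A ^ 2 * (B ^ 2 * ?C)) ^ 4"
    by (intro power_mono) auto
  also have "\<dots> = (A * B) ^ 8 * real (card S) ^ 4 * ?C ^ 4"
    by (simp add: power_mult_distrib flip: power_mult)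
  finally have W8: "norm ?W ^ 8 \<le> (A * B) ^ 8 * real (card S) ^ 4 * ?C ^ 4"
    by (simp flip: power_mult)
  define \<nu> where "\<nu> h = real (card {p \<in> T \<times> T. nat (\<delta> p mod int q) = h})" for h
  \<comment> \<open>The sum over pairs is regrouped by residues, so that the moments of \<open>R\<close> over
    all residues become available.\<close>
  have R_mod: "R (\<delta> p) = R (int (nat (\<delta> p mod int q)))" for p
    unfolding R_def using q
    by (intro sum.cong refl add_char_cong cong_scalar_right) simp_all
  have "?C ^ 2 \<le> (\<Sum>p\<in>T \<times> T. 1 ^ 2) * (\<Sum>p\<in>T \<times> T. norm (R (\<delta> p)) ^ 2)"
    using Cauchy_Schwarz_ineq_sum[of "\<lambda>_. 1" "\<lambda>p. norm (R (\<delta> p))" "T \<times> T"] by simp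
  also have "(\<Sum>p\<in>T \<times> T. norm (R (\<delta> p)) ^ 2) = (\<Sum>h<q. \<Sum>p\<in>{p \<in> T \<times> T. nat (\<delta> p mod int q) = h}. norm (R (\<delta> p)) ^ 2)"
    using assms(4) q by (intro sum.group[symmetric]) (auto simp: nat_less_iff)
  also have "\<dots> = (\<Sum>h<q. \<nu> h * norm (R (int h)) ^ 2)"
  proof (intro sum.cong refl)
    fix h
    have "(\<Sum>p\<in>{p \<in> T \<times> T. nat (\<delta> p mod int q) = h}. norm (R (\<delta> p)) ^ 2) =
        (\<Sum>p\<in>{p \<in> T \<times> T. nat (\<delta> p mod int q) = h}. norm (R (int h)) ^ 2)"
      by (intro sum.cong refl) (subst R_mod, simp)
    then show "(\<Sum>p\<in>{p \<in> T \<times> T. nat (\<delta> p mod int q) = h}. norm (R (\<delta> p)) ^ 2) = \<nu> h * norm (R (int h)) ^ 2"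
      by (simp add: \<nu>_def)
  qed
  finally have C2: "?C ^ 2 \<le> real (card T) ^ 2 * (\<Sum>h<q. \<nu> h * norm (R (int h)) ^ 2)"
    by (simp add: card_cartesian_product power2_eq_square)
  have "(\<Sum>h<q. \<nu> h * norm (R (int h)) ^ 2) ^ 2 \<le> (\<Sum>h<q. \<nu> h ^ 2) * (\<Sum>h<q. (norm (R (int h)) ^ 2) ^ 2)"
    by (rule Cauchy_Schwarz_ineq_sum)
  also have "(\<Sum>h<q. (norm (R (int h)) ^ 2) ^ 2) = real q * inv_energy q S"
    unfolding R_def inv_sum_fourth_moment[OF assms(1-3), symmetric] by (simp flip: power_mult)
  also have "(\<Sum>h<q. \<nu> h ^ 2) = real (inv_energy q T)"
  proof -
    have "inv_energy q T = card {(s, t). s \<in> T \<times> T \<and> t \<in> T \<times> T \<and> nat (\<delta> s mod int q) = nat (\<delta> t mod int q)}"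
      unfolding inv_energy_eq_differences[OF q] \<delta>_def using q by (simp add: eq_nat_nat_iff)
    also have "\<dots> = (\<Sum>h\<in>(\<lambda>p. nat (\<delta> p mod int q)) ` (T \<times> T). card {p \<in> T \<times> T. nat (\<delta> p mod int q) = h} ^ 2)"
      using assms(4) by (intro card_equal_pairs) auto
    also have "real \<dots> = (\<Sum>h\<in>(\<lambda>p. nat (\<delta> p mod int q)) ` (T \<times> T). \<nu> h ^ 2)"
      by (simp add: \<nu>_def)
    also have "\<dots> = (\<Sum>h<q. \<nu> h ^ 2)"
    proof (intro sum.mono_neutral_left ballI)
      fix h assume "h \<in> {..<q} - (\<lambda>p. nat (\<delta> p mod int q)) ` (T \<times> T)"
      then have "{p \<in> T \<times> T. nat (\<delta> p mod int q) = h} = {}" by blast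
      then show "\<nu> h ^ 2 = 0" unfolding \<nu>_def by (simp only:) simp
    qed (use q in \<open>auto simp: nat_less_iff\<close>)
    finally show ?thesis ..
  qed
  finally have N2: "(\<Sum>h<q. \<nu> h * norm (R (int h)) ^ 2) ^ 2 \<le> real (inv_energy q T) * (real q * inv_energy q S)" .
  have "(?C ^ 2) ^ 2 \<le> (real (card T) ^ 2 * (\<Sum>h<q. \<nu> h * norm (R (int h)) ^ 2)) ^ 2"
    by (intro power_mono C2) auto
  also have "\<dots> = real (card T) ^ 4 * (\<Sum>h<q. \<nu> h * norm (R (int h)) ^ 2) ^ 2"
    by (simp add: power_mult_distrib flip: power_mult)
  also have "\<dots> \<le> real (card T) ^ 4 * (real (inv_energy q T) * (real q * inv_energy q S))"
    by (intro mult_left_mono N2) auto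
  finally have "?C ^ 4 \<le> real (card T) ^ 4 * (real (inv_energy q T) * (real q * inv_energy q S))"
    by (simp flip: power_mult)
  then have "(A * B) ^ 8 * real (card S) ^ 4 * ?C ^ 4 \<le>
      (A * B) ^ 8 * real (card S) ^ 4 * (real (card T) ^ 4 * (real (inv_energy q T) * (real q * inv_energy q S)))"
    by (intro mult_left_mono) auto
  with W8 show ?thesis
    by (simp add: power_mult_distrib mult_ac)
qed

section \<open>Vaughan's identity\<close>

definition moebius :: "nat \<Rightarrow> real" where
  "moebius n = (if squarefree n then (- 1) ^ card (prime_factors n) else 0)"

lemma abs_moebius_le: "\<bar>moebius n\<bar> \<le> 1"
  by (simp add: moebius_def power_abs)

lemma moebius_prime_mult:
  assumes "prime p" "\<not> p dvd d" "squarefree d"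
  shows "moebius (p * d) = - moebius d"
proof -
  have d: "d \<noteq> 0" using assms(2) by (metis dvd_0_right)
  have "coprime p d" using assms(1,2) by (rule prime_imp_coprime)
  then have "squarefree (p * d)"
    using assms by (simp add: squarefree_mult_coprime squarefree_prime)
  moreover have "prime_factors (p * d) = insert p (prime_factors d)"
    using assms(1) d by (simp add: prime_factors_product prime_factorization_prime)
  moreover have "p \<notin> prime_factors d" using assms(2) by (auto simp: in_prime_factors_iff)
  ultimately show ?thesis using assms(3) by (simp add: moebius_def)
qed

text \<open>
  For a prime divisor \<open>p\<close> of \<open>n\<close>, the squarefree divisors come in pairs \<open>d, p d\<close> with opposite signs.
\<close>

lemma sum_moebius_divisors:
  assumes "n > 0"
  shows "(\<Sum>d | d dvd n. moebius d) = (if n = 1 then 1 else 0)"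
proof (cases "n = 1")
  case True
  then have "{d. d dvd n} = {1}" by auto
  with True show ?thesis by (simp add: moebius_def)
next
  case False
  then obtain p where p: "prime p" "p dvd n" using prime_factor_nat by blast
  define A where "A = {d. d dvd n \<and> squarefree d \<and> \<not> p dvd d}"
  have fin: "finite {d. d dvd n}" using assms by (rule finite_divisors_nat)
  have finA: "finite A" by (rule finite_subset[OF _ fin]) (auto simp: A_def)
  have "(\<Sum>d | d dvd n. moebius d) = (\<Sum>d | d dvd n \<and> squarefree d. moebius d)"
    using fin by (intro sum.mono_neutral_right) (auto simp: moebius_def)
  also have "{d. d dvd n \<and> squarefree d} = A \<union> (\<lambda>d. p * d) ` A"
  proof (intro equalityI subsetI)
    fix d assume d: "d \<in> {d. d dvd n \<and> squarefree d}"
    show "d \<in> A \<union> (\<lambda>d. p * d) ` A"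
    proof (cases "p dvd d")
      case True
      then obtain e where e: "d = p * e" by blast
      have "\<not> p dvd e"
      proof
        assume "p dvd e"
        then have "p ^ 2 dvd d" unfolding e power2_eq_square by simp
        with d have "is_unit p" by (auto simp: squarefree_def)
        with p show False by simp
      qed
      moreover have "squarefree e" using d unfolding e by (auto dest: squarefree_multD)
      moreover have "e dvd n" using d unfolding e by (auto dest: dvd_mult_right)
      ultimately have "e \<in> A" by (simp add: A_def)
      with e show ?thesis by blast
    qed (use d in \<open>auto simp: A_def\<close>)
  next
    fix d assume "d \<in> A \<union> (\<lambda>d. p * d) ` A"
    then show "d \<in> {d. d dvd n \<and> squarefree d}"
    proof
      assume "d \<in> (\<lambda>d. p * d) ` A"
      then obtain e where e: "e \<in> A" "d = p * e" by blast
      then have "coprime p e" using p by (auto simp: A_def intro: prime_imp_coprime)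
      then have "p * e dvd n" "squarefree (p * e)"
        using e p by (auto simp: A_def divides_mult squarefree_mult_coprime squarefree_prime)
      with e show ?thesis by simp
    qed (auto simp: A_def)
  qed
  also have "(\<Sum>d\<in>A \<union> (\<lambda>d. p * d) ` A. moebius d) = (\<Sum>d\<in>A. moebius d) + (\<Sum>d\<in>(\<lambda>d. p * d) ` A. moebius d)"
    using finA by (intro sum.union_disjoint) (auto simp: A_def)
  also have "(\<Sum>d\<in>(\<lambda>d. p * d) ` A. moebius d) = (\<Sum>d\<in>A. moebius (p * d))"
    using p prime_gt_0_nat by (subst sum.reindex) (auto simp: inj_on_def)
  also have "\<dots> = (\<Sum>d\<in>A. - moebius d)"
    by (intro sum.cong refl) (auto simp: A_def moebius_prime_mult p)
  finally show ?thesis using False by (simp add: sum_negf)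
qed

lemma sum_divisor_weight:
  fixes w :: "nat \<Rightarrow> real" and G :: "nat \<Rightarrow> complex"
  assumes "finite B" "0 \<notin> B"
  shows "(\<Sum>m = 1..Z. of_real (\<Sum>b | b \<in> B \<and> b dvd m. w b) * G m) =
         (\<Sum>b\<in>B. of_real (w b) * (\<Sum>j = 1..Z div b. G (b * j)))"
proof -
  have "(\<Sum>m = 1..Z. of_real (\<Sum>b | b \<in> B \<and> b dvd m. w b) * G m) =
      (\<Sum>m = 1..Z. \<Sum>b\<in>B. if b dvd m then of_real (w b) * G m else 0)"
    using assms(1) by (intro sum.cong refl) (auto simp: sum_distrib_right sum.inter_filter intro!: sum.cong)
  also have "\<dots> = (\<Sum>b\<in>B. \<Sum>m = 1..Z. if b dvd m then of_real (w b) * G m else 0)"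
    by (rule sum.swap)
  also have "\<dots> = (\<Sum>b\<in>B. of_real (w b) * (\<Sum>j = 1..Z div b. G (b * j)))"
  proof (intro sum.cong refl)
    fix b assume "b \<in> B"
    with assms have b: "b > 0" by (auto intro!: Nat.gr0I)
    have "(\<Sum>m = 1..Z. if b dvd m then of_real (w b) * G m else 0) =
        (\<Sum>m\<in>{m \<in> {1..Z}. b dvd m}. of_real (w b) * G m)"
      by (subst sum.inter_filter) simp_all
    also have "\<dots> = (\<Sum>j = 1..Z div b. of_real (w b) * G (b * j))"
      using b by (intro sum.reindex_bij_witness[of _ "\<lambda>j. b * j" "\<lambda>m. m div b"])
        (auto simp: div_le_mono less_eq_div_iff_mult_less_eq mult.commute Suc_le_eq dvd_div_eq_0_iff)
    finally show "(\<Sum>m = 1..Z. if b dvd m then of_real (w b) * G m else 0) =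
        of_real (w b) * (\<Sum>j = 1..Z div b. G (b * j))"
      by (simp add: sum_distrib_left)
  qed
  finally show ?thesis .
qed

text \<open>
  The convolution of the parts of the von Mangoldt and Moebius functions supported on \<open>{1..u}\<close>.
\<close>

definition vaughan_low :: "nat \<Rightarrow> nat \<Rightarrow> real" where
  "vaughan_low u d = (\<Sum>p | p \<in> {1..u} \<times> {1..u} \<and> fst p * snd p = d. mangoldt (fst p) * moebius (snd p))"

definition vaughan_high :: "nat \<Rightarrow> nat \<Rightarrow> real" where
  "vaughan_high u m = (\<Sum>b | b dvd m \<and> u < b. moebius b)"

text \<open>
  The sum of \<open>moebius b\<close> over the divisors \<open>b\<close> of \<open>m\<close> is the indicator function of \<open>m = 1\<close>, so the left-hand side
  is a sum over all products \<open>c m \<le> Y\<close> with \<open>u < c\<close>. The divisors \<open>b > u\<close> give the last term. For the small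
  divisors, extend the sum from \<open>u < c \<le> Y\<close> to all \<open>c \<le> Y\<close>; the von Mangoldt function then sums to the logarithm
  over the divisors of \<open>k = c j\<close>, which gives the first term, and the added terms with \<open>c \<le> u\<close> are the second one.
\<close>

lemma vaughan_identity:
  fixes F :: "nat \<Rightarrow> complex"
  shows "(\<Sum>n\<in>{u<..Y}. of_real (mangoldt n) * F n) =
     (\<Sum>b = 1..u. of_real (moebius b) * (\<Sum>k = 1..Y div b. of_real (ln (real k)) * F (b * k)))
     - (\<Sum>d = 1..u ^ 2. of_real (vaughan_low u d) * (\<Sum>k = 1..Y div d. F (d * k)))
     + (\<Sum>c\<in>{u<..Y}. of_real (mangoldt c) * (\<Sum>m = 1..Y div c. of_real (vaughan_high u m) * F (c * m)))"
proof -
  define low where "low m = (\<Sum>b | b \<in> {1..u} \<and> b dvd m. moebius b)" for m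
  have split: "low m + vaughan_high u m = (if m = 1 then 1 else 0)" if "m > 0" for m
  proof -
    let ?A = "{b. b \<in> {1..u} \<and> b dvd m}" and ?B = "{b. b dvd m \<and> u < b}"
    have fin: "finite {d. d dvd m}" using that by (rule finite_divisors_nat)
    have "d \<in> {d. d dvd m} \<longleftrightarrow> d \<in> ?A \<union> ?B" for d
      using dvd_pos_nat[OF that, of d] by (cases "d dvd m") auto
    then have eq: "{d. d dvd m} = ?A \<union> ?B" by blast
    have "(\<Sum>d\<in>?A \<union> ?B. moebius d) = (\<Sum>d\<in>?A. moebius d) + (\<Sum>d\<in>?B. moebius d)"
    proof (rule sum.union_disjoint)
      show "finite ?B" by (rule finite_subset[OF _ fin]) blast
    qed auto
    then have "(\<Sum>d | d dvd m. moebius d) = low m + vaughan_high u m"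
      by (simp only: eq low_def vaughan_high_def)
    with sum_moebius_divisors[OF that] show ?thesis by simp
  qed
  define H where "H c = (\<Sum>m = 1..Y div c. of_real (low m) * F (c * m))" for c
  have H: "H c = (\<Sum>b = 1..u. of_real (moebius b) * (\<Sum>j = 1..Y div c div b. F (c * (b * j))))" for c
    unfolding H_def low_def by (rule sum_divisor_weight) auto
  have "(\<Sum>n\<in>{u<..Y}. of_real (mangoldt n) * F n) =
      (\<Sum>c\<in>{u<..Y}. of_real (mangoldt c) * (\<Sum>m = 1..Y div c. of_real (low m + vaughan_high u m) * F (c * m)))"
  proof (intro sum.cong refl)
    fix c assume c: "c \<in> {u<..Y}"
    have "(\<Sum>m = 1..Y div c. of_real (low m + vaughan_high u m) * F (c * m)) =
        (\<Sum>m = 1..Y div c. if m = 1 then F c else 0)"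
      by (intro sum.cong refl) (subst split, auto)
    also have "\<dots> = F c"
      using c by (simp add: sum.delta Suc_le_eq div_greater_zero_iff)
    finally show "of_real (mangoldt c) * F c =
        of_real (mangoldt c) * (\<Sum>m = 1..Y div c. of_real (low m + vaughan_high u m) * F (c * m))" by simp
  qed
  also have "\<dots> = (\<Sum>c\<in>{u<..Y}. of_real (mangoldt c) * H c) +
      (\<Sum>c\<in>{u<..Y}. of_real (mangoldt c) * (\<Sum>m = 1..Y div c. of_real (vaughan_high u m) * F (c * m)))"
    by (simp add: H_def distrib_right distrib_left sum.distrib)
  also have "(\<Sum>c\<in>{u<..Y}. of_real (mangoldt c) * H c) =
      (\<Sum>c = 1..Y. of_real (mangoldt c) * H c) - (\<Sum>c = 1..u. of_real (mangoldt c) * H c)"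
  proof (cases "u \<le> Y")
    case True
    then have "{1..Y} = {1..u} \<union> {u<..Y}" by auto
    then have "(\<Sum>c = 1..Y. of_real (mangoldt c) * H c) =
        (\<Sum>c = 1..u. of_real (mangoldt c) * H c) + (\<Sum>c\<in>{u<..Y}. of_real (mangoldt c) * H c)"
      by (subst sum.union_disjoint[symmetric]) auto
    then show ?thesis by simp
  next
    case False
    have "(\<Sum>c = 1..Y. of_real (mangoldt c) * H c) = (\<Sum>c = 1..u. of_real (mangoldt c) * H c)"
      using False by (intro sum.mono_neutral_left) (auto simp: H_def)
    with False show ?thesis by simp
  qed
  also have "(\<Sum>c = 1..Y. of_real (mangoldt c) * H c) =
      (\<Sum>b = 1..u. of_real (moebius b) * (\<Sum>k = 1..Y div b. of_real (ln (real k)) * F (b * k)))"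
  proof -
    have "(\<Sum>c = 1..Y. of_real (mangoldt c) * H c) =
        (\<Sum>b = 1..u. of_real (moebius b) * (\<Sum>c = 1..Y. of_real (mangoldt c) * (\<Sum>j = 1..Y div b div c. F (b * (c * j)))))"
      unfolding H sum_distrib_left
      by (subst sum.swap) (simp add: mult_ac div_mult2_eq[symmetric])
    also have "\<dots> = (\<Sum>b = 1..u. of_real (moebius b) * (\<Sum>k = 1..Y div b. of_real (ln (real k)) * F (b * k)))"
    proof (intro sum.cong refl)
      fix b
      have "(\<Sum>c = 1..Y. of_real (mangoldt c) * (\<Sum>j = 1..Y div b div c. F (b * (c * j)))) =
          (\<Sum>k = 1..Y div b. of_real (\<Sum>c | c \<in> {1..Y} \<and> c dvd k. mangoldt c) * F (b * k))"
        by (rule sum_divisor_weight[symmetric]) auto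
      also have "\<dots> = (\<Sum>k = 1..Y div b. of_real (ln (real k)) * F (b * k))"
      proof (intro sum.cong refl)
        fix k assume k: "k \<in> {1..Y div b}"
        then have "k \<le> Y" using div_le_dividend order_trans by fastforce
        moreover have "k > 0" using k by simp
        ultimately have "c \<in> {1..Y} \<and> c dvd k \<longleftrightarrow> c dvd k" for c
          using dvd_pos_nat[of k c] dvd_imp_le[of c k] by (cases "c dvd k") auto
        then have "(\<Sum>c | c \<in> {1..Y} \<and> c dvd k. mangoldt c) = ln (real k)"
          using mangoldt_sum[of k, where ?'a = real] k by simp
        then show "of_real (\<Sum>c | c \<in> {1..Y} \<and> c dvd k. mangoldt c) * F (b * k) = of_real (ln (real k)) * F (b * k)"
          by simp
      qed
      finally show "of_real (moebius b) * (\<Sum>c = 1..Y. of_real (mangoldt c) * (\<Sum>j = 1..Y div b div c. F (b * (c * j)))) =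
          of_real (moebius b) * (\<Sum>k = 1..Y div b. of_real (ln (real k)) * F (b * k))"
        by (simp only:)
    qed
    finally show ?thesis .
  qed
  also have "(\<Sum>c = 1..u. of_real (mangoldt c) * H c) =
      (\<Sum>d = 1..u ^ 2. of_real (vaughan_low u d) * (\<Sum>k = 1..Y div d. F (d * k)))"
  proof -
    let ?R = "{1..u} \<times> {1..u}"
    define \<Phi> where "\<Phi> d = (\<Sum>k = 1..Y div d. F (d * k))" for d
    have "(\<Sum>c = 1..u. of_real (mangoldt c) * H c) =
        (\<Sum>p\<in>?R. of_real (mangoldt (fst p) * moebius (snd p)) * \<Phi> (fst p * snd p))"
      unfolding H \<Phi>_def sum_distrib_left
      by (simp add: sum.cartesian_product case_prod_unfold mult_ac div_mult2_eq)
    also have "\<dots> = (\<Sum>d = 1..u ^ 2. \<Sum>p | p \<in> ?R \<and> fst p * snd p = d.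
        of_real (mangoldt (fst p) * moebius (snd p)) * \<Phi> (fst p * snd p))"
      by (intro sum.group[symmetric]) (auto simp: power2_eq_square mult_le_mono Suc_le_eq)
    also have "\<dots> = (\<Sum>d = 1..u ^ 2. of_real (vaughan_low u d) * \<Phi> d)"
      unfolding vaughan_low_def of_real_sum sum_distrib_right
      by (intro sum.cong refl) auto
    finally show ?thesis unfolding \<Phi>_def .
  qed
  finally show ?thesis by simp
qed

lemma abs_vaughan_low_le:
  assumes "d > 0"
  shows "\<bar>vaughan_low u d\<bar> \<le> ln (real d)"
proof -
  let ?P = "{p. p \<in> {1..u} \<times> {1..u} \<and> fst p * snd p = d}"
  have fin: "finite ?P" by (rule finite_subset[of _ "{1..u} \<times> {1..u}"]) auto
  have inj: "inj_on fst ?P"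
    using assms by (auto simp: inj_on_def)
  have "\<bar>vaughan_low u d\<bar> \<le> (\<Sum>p\<in>?P. mangoldt (fst p))"
    unfolding vaughan_low_def using abs_moebius_le
    by (intro order_trans[OF sum_abs] sum_mono) (auto simp: abs_mult mangoldt_nonneg intro: mult_left_le)
  also have "\<dots> = (\<Sum>c\<in>fst ` ?P. mangoldt c)"
    by (subst sum.reindex[OF inj]) (simp add: o_def)
  also have "\<dots> \<le> (\<Sum>c | c dvd d. mangoldt c)"
    using assms by (intro sum_mono2 finite_divisors_nat) (auto simp: mangoldt_nonneg)
  also have "\<dots> = ln (real d)"
    using mangoldt_sum[of d, where ?'a = real] assms by simp
  finally show ?thesis .
qed

lemma abs_vaughan_high_le:
  assumes "m > 0"
  shows "\<bar>vaughan_high u m\<bar> \<le> real (card {d. d dvd m})"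
proof -
  have fin: "finite {d. d dvd m}" using assms by (rule finite_divisors_nat)
  have "\<bar>vaughan_high u m\<bar> \<le> (\<Sum>b | b dvd m \<and> u < b. 1)"
    unfolding vaughan_high_def by (intro order_trans[OF sum_abs] sum_mono abs_moebius_le)
  also have "\<dots> \<le> (\<Sum>b | b dvd m. 1)"
    using fin by (intro sum_mono2) auto
  finally show ?thesis by simp
qed

lemma vaughan_high_eq_0:
  assumes "m \<le> u" "m > 0"
  shows "vaughan_high u m = 0"
proof -
  have "{b. b dvd m \<and> u < b} = {}" using assms by (auto dest: dvd_imp_le)
  then show ?thesis unfolding vaughan_high_def by (simp only: sum.empty)
qed

section \<open>Divisors, prime powers and partial summation\<close>

lemma card_divisors_prime_power_mult_le:
  assumes "prime (p :: nat)" "m > 0"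
  shows "card {d. d dvd p ^ k * m} \<le> (k + 1) * card {d. d dvd m}"
proof -
  have "{d. d dvd p ^ k * m} \<subseteq> (\<lambda>(i, d). p ^ i * d) ` ({..k} \<times> {d. d dvd m})"
  proof
    fix d assume "d \<in> {d. d dvd p ^ k * m}"
    then have "d dvd p ^ k * m" by simp
    then obtain a b where ab: "d = a * b" "a dvd p ^ k" "b dvd m" using division_decomp[of d "p ^ k" m] by blast
    then obtain i where "i \<le> k" "a = p ^ i" using divides_primepow_nat[OF assms(1)] by blast
    then show "d \<in> (\<lambda>(i, d). p ^ i * d) ` ({..k} \<times> {d. d dvd m})" using ab by auto
  qed
  then have "card {d. d dvd p ^ k * m} \<le> card ((\<lambda>(i, d). p ^ i * d) ` ({..k} \<times> {d. d dvd m}))"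
    using assms(2) by (intro card_mono finite_imageI finite_cartesian_product) (auto simp: finite_divisors_nat)
  also have "\<dots> \<le> card ({..k} \<times> {d. d dvd m})"
    using assms(2) by (intro card_image_le finite_cartesian_product) (auto simp: finite_divisors_nat)
  finally show ?thesis by (simp add: card_cartesian_product)
qed

text \<open>
  Split off the full power \<open>p^k\<close> of a prime from \<open>n\<close>; the number of divisors changes by a factor of at most \<open>k + 1\<close>.
  This is at most \<open>2^k \<le> p^(k \<epsilon>)\<close> unless \<open>p^\<epsilon> < 2\<close>. The latter holds only for the finitely many primes in \<open>P\<close>, and
  each of these costs at most a constant factor \<open>c\<close>.
\<close>

lemma divisor_bound:
  assumes "(\<epsilon>::real) > 0"
  obtains D where "\<And>n::nat. n > 0 \<Longrightarrow> real (card {d. d dvd n}) \<le> D * real n powr \<epsilon>"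
proof -
  \<comment> \<open>With this \<open>c\<close> one has \<open>k + 1 \<le> c (1 + k \<epsilon> ln 2) \<le> c 2^(k \<epsilon>)\<close>.\<close>
  define c where "c = max 1 (1 / (\<epsilon> * ln 2))"
  define P where "P = {p::nat. prime p \<and> real p powr \<epsilon> < 2}"
  have c1: "c \<ge> 1" by (simp add: c_def)
  have "P \<subseteq> {..nat \<lfloor>2 powr (1 / \<epsilon>)\<rfloor>}"
  proof
    fix p assume p: "p \<in> P"
    then have "(real p powr \<epsilon>) powr (1 / \<epsilon>) \<le> 2 powr (1 / \<epsilon>)"
      using assms by (intro powr_mono2) (auto simp: P_def)
    then have "real p \<le> 2 powr (1 / \<epsilon>)"
      using assms by (simp add: powr_powr)
    then show "p \<in> {..nat \<lfloor>2 powr (1 / \<epsilon>)\<rfloor>}" by (simp add: le_nat_floor)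
  qed
  then have finP: "finite P" using finite_subset by blast
  have small: "real k + 1 \<le> c * (real p ^ k) powr \<epsilon>" if "p \<ge> 2" for p k :: nat
  proof -
    have "1 + real k * (\<epsilon> * ln 2) \<le> exp (real k * (\<epsilon> * ln 2))"
      by (rule exp_ge_add_one_self)
    also have "exp (real k * (\<epsilon> * ln 2)) = (2 ^ k) powr \<epsilon>"
      by (simp add: powr_def ln_realpow mult_ac)
    also have "\<dots> \<le> (real p ^ k) powr \<epsilon>"
      using that assms by (intro powr_mono2 power_mono) auto
    finally have e: "1 + real k * (\<epsilon> * ln 2) \<le> (real p ^ k) powr \<epsilon>" .
    have "real k + 1 \<le> c + c * (real k * (\<epsilon> * ln 2))"
    proof -
      have "1 \<le> c * (\<epsilon> * ln 2)"
      proof -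
        have "1 / (\<epsilon> * ln 2) * (\<epsilon> * ln 2) \<le> c * (\<epsilon> * ln 2)"
          using assms by (intro mult_right_mono) (auto simp: c_def)
        then show ?thesis using assms by simp
      qed
      then have "real k * 1 \<le> real k * (c * (\<epsilon> * ln 2))" by (intro mult_left_mono) auto
      then show ?thesis using c1 by (simp add: mult_ac)
    qed
    also have "\<dots> = c * (1 + real k * (\<epsilon> * ln 2))" by (simp add: algebra_simps)
    also have "\<dots> \<le> c * (real p ^ k) powr \<epsilon>" using e c1 by (intro mult_left_mono) auto
    finally show ?thesis .
  qed
  have large: "real k + 1 \<le> (real p ^ k) powr \<epsilon>" if "p > 0" "\<not> real p powr \<epsilon> < 2" for p k :: nat
  proof -
    have "k + 1 \<le> 2 ^ k" by (induction k) auto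
    then have "real (k + 1) \<le> real (2 ^ k)" by (simp only: of_nat_le_iff)
    then have "real k + 1 \<le> 2 ^ k" by simp
    also have "\<dots> \<le> (real p powr \<epsilon>) ^ k" using that by (intro power_mono) auto
    also have "\<dots> = (real p ^ k) powr \<epsilon>"
      using that by (simp add: powr_power powr_powr mult.commute flip: powr_realpow)
    finally show ?thesis .
  qed
  have "real (card {d. d dvd n}) \<le> c ^ card {p \<in> P. p dvd n} * real n powr \<epsilon>" if "n > 0" for n :: nat
    using that
  proof (induction n rule: less_induct)
    case (less n)
    show ?case
    proof (cases "n = 1")
      case True
      then show ?thesis using c1 by simp
    next
      case False
      then obtain p where p: "prime p" "p dvd n" using prime_factor_nat by blast
      define k where "k = multiplicity p n"
      obtain m where m: "n = p ^ k * m" "\<not> p dvd m"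
        using multiplicity_decompose'[of n p] less.prems prime_gt_1_nat[OF p(1)]
        unfolding k_def by auto
      have m0: "m > 0" using less.prems m by (auto intro!: Nat.gr0I)
      have p2: "p \<ge> 2" using prime_ge_2_nat[OF p(1)] .
      have k0: "k > 0" using p less.prems by (simp add: k_def prime_multiplicity_gt_zero_iff)
      have "1 < p ^ k" using p2 k0 by (intro one_less_power) auto
      then have mn: "m < n" using m m0 by simp
      have "real (card {d. d dvd n}) \<le> (real k + 1) * real (card {d. d dvd m})"
        using of_nat_mono[OF card_divisors_prime_power_mult_le[OF p(1) m0, of k], where ?'a = real]
        by (simp add: m(1) algebra_simps)
      also have "\<dots> \<le> (real k + 1) * (c ^ card {p \<in> P. p dvd m} * real m powr \<epsilon>)"
        using less.IH[OF mn m0] by (intro mult_left_mono) auto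
      also have "\<dots> \<le> c ^ card {p \<in> P. p dvd n} * (real p ^ k) powr \<epsilon> * real m powr \<epsilon>"
      proof (cases "real p powr \<epsilon> < 2")
        case True
        have "insert p {p \<in> P. p dvd m} \<subseteq> {p \<in> P. p dvd n}"
          using p True m by (auto simp: P_def)
        then have "card (insert p {p \<in> P. p dvd m}) \<le> card {p \<in> P. p dvd n}"
          using finP by (intro card_mono) auto
        then have "Suc (card {p \<in> P. p dvd m}) \<le> card {p \<in> P. p dvd n}"
          using finP m(2) by simp
        then have "c ^ Suc (card {p \<in> P. p dvd m}) \<le> c ^ card {p \<in> P. p dvd n}"
          using c1 by (rule power_increasing)
        then have "c * (real p ^ k) powr \<epsilon> * (c ^ card {p \<in> P. p dvd m} * real m powr \<epsilon>) \<le>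
            c ^ card {p \<in> P. p dvd n} * ((real p ^ k) powr \<epsilon> * real m powr \<epsilon>)"
          using mult_right_mono[of "c ^ Suc (card {p \<in> P. p dvd m})" "c ^ card {p \<in> P. p dvd n}"
              "(real p ^ k) powr \<epsilon> * real m powr \<epsilon>"] by (simp add: mult_ac)
        moreover have "(real k + 1) * (c ^ card {p \<in> P. p dvd m} * real m powr \<epsilon>) \<le>
            c * (real p ^ k) powr \<epsilon> * (c ^ card {p \<in> P. p dvd m} * real m powr \<epsilon>)"
          using small[OF p2, of k] c1 by (intro mult_right_mono) auto
        ultimately show ?thesis by (simp add: mult.assoc)
      next
        case False
        have "card {p \<in> P. p dvd m} \<le> card {p \<in> P. p dvd n}"
          using finP m by (intro card_mono) auto
        then have "c ^ card {p \<in> P. p dvd m} \<le> c ^ card {p \<in> P. p dvd n}"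
          using c1 by (rule power_increasing)
        moreover have "real k + 1 \<le> (real p ^ k) powr \<epsilon>"
          using p2 False by (intro large) auto
        ultimately have "(real k + 1) * c ^ card {p \<in> P. p dvd m} \<le> (real p ^ k) powr \<epsilon> * c ^ card {p \<in> P. p dvd n}"
          using c1 by (intro mult_mono) auto
        from mult_right_mono[OF this, of "real m powr \<epsilon>"] show ?thesis
          by (simp add: mult_ac)
      qed
      also have "\<dots> = c ^ card {p \<in> P. p dvd n} * real n powr \<epsilon>"
        by (simp add: m(1) powr_mult)
      finally show ?thesis .
    qed
  qed
  moreover have "c ^ card {p \<in> P. p dvd n} * real n powr \<epsilon> \<le> c ^ card P * real n powr \<epsilon>" for n
    using finP c1 by (intro mult_right_mono power_increasing card_mono) auto
  ultimately have "real (card {d. d dvd n}) \<le> c ^ card P * real n powr \<epsilon>" if "n > 0" for n :: nat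
    using that order_trans by blast
  then show thesis by (rule that)
qed

lemma floor_log_le_2_ln:
  assumes "Y > 0"
  shows "real (floor_log Y) \<le> 2 * ln (real Y)"
proof -
  have "2 ^ floor_log Y \<le> Y" using assms floor_log_exp2_le by simp
  then have "real (2 ^ floor_log Y) \<le> real Y" by (simp only: of_nat_le_iff)
  then have "(2::real) ^ floor_log Y \<le> real Y" by simp
  then have "ln ((2::real) ^ floor_log Y) \<le> ln (real Y)" using assms by (intro ln_mono) auto
  then have "real (floor_log Y) * ln 2 \<le> ln (real Y)" by (simp add: ln_realpow)
  moreover have "1 / 2 \<le> ln (2::real)" using ln2_ge_two_thirds by simp
  then have "real (floor_log Y) * (1 / 2) \<le> real (floor_log Y) * ln 2" by (intro mult_left_mono) auto
  ultimately show ?thesis by simp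
qed

text \<open>
  A proper prime power up to \<open>Y\<close> is \<open>p^k\<close> with \<open>p \<le> sqrt Y\<close> and \<open>k \<le> log\<^sub>2 Y\<close>.
\<close>

lemma sum_mangoldt_prime_powers_le:
  "(\<Sum>n | n \<in> {1..Y} \<and> \<not> prime n. mangoldt n) \<le> 2 * sqrt (real Y) * ln (real Y) ^ 2"
proof (cases "Y = 0")
  case False
  let ?A = "{n \<in> {1..Y}. \<not> prime n \<and> primepow n}"
  have "?A \<subseteq> (\<lambda>(p, k). p ^ k) ` ({1..floor_sqrt Y} \<times> {1..floor_log Y})"
  proof
    fix n assume n: "n \<in> ?A"
    then obtain p k where pk: "prime p" "k > 0" "n = p ^ k" by (auto simp: primepow_def)
    then have k2: "k \<ge> 2" using n by (cases "k = 1") auto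
    have p2: "p \<ge> 2" using prime_ge_2_nat[OF pk(1)] .
    have "p ^ 2 \<le> p ^ k" using k2 p2 by (intro power_increasing) auto
    then have "p \<le> floor_sqrt Y" using n pk by (intro le_floor_sqrtI) auto
    moreover have "2 ^ k \<le> p ^ k" using p2 by (intro power_mono) auto
    then have "2 ^ k \<le> Y" by (rule order_trans) (use n pk in auto)
    then have "floor_log (2 ^ k) \<le> floor_log Y" by (rule floor_log_le_iff)
    then have "k \<le> floor_log Y" by simp
    ultimately have "(p, k) \<in> {1..floor_sqrt Y} \<times> {1..floor_log Y}" using p2 k2 by auto
    then show "n \<in> (\<lambda>(p, k). p ^ k) ` ({1..floor_sqrt Y} \<times> {1..floor_log Y})"
      by (rule rev_image_eqI) (simp add: pk)
  qed
  then have "card ?A \<le> card ((\<lambda>(p, k). p ^ k) ` ({1..floor_sqrt Y} \<times> {1..floor_log Y}))"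
    by (intro card_mono) auto
  also have "\<dots> \<le> floor_sqrt Y * floor_log Y"
    by (rule order_trans[OF card_image_le]) (auto simp: card_cartesian_product)
  finally have "real (card ?A) \<le> real (floor_sqrt Y * floor_log Y)"
    by (simp only: of_nat_le_iff)
  then have "real (card ?A) \<le> real (floor_sqrt Y) * real (floor_log Y)"
    by simp
  moreover have "real (floor_sqrt Y) \<le> sqrt (real Y)"
    using of_nat_mono[OF floor_sqrt_power2_le[of Y], where ?'a = real] by (intro real_le_rsqrt) simp
  moreover have "real (floor_log Y) \<le> 2 * ln (real Y)"
    using False by (intro floor_log_le_2_ln) simp
  ultimately have cardA: "real (card ?A) \<le> sqrt (real Y) * (2 * ln (real Y))"
    by (elim order_trans) (intro mult_mono, auto)
  have "(\<Sum>n | n \<in> {1..Y} \<and> \<not> prime n. mangoldt n :: real) = (\<Sum>n\<in>?A. mangoldt n)"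
    by (intro sum.mono_neutral_right) (auto simp: mangoldt_def)
  also have "\<dots> \<le> (\<Sum>n\<in>?A. ln (real Y))"
  proof (intro sum_mono)
    fix n assume n: "n \<in> ?A"
    then have "mangoldt n \<le> ln (real n)" by (intro mangoldt_le) auto
    also have "\<dots> \<le> ln (real Y)" using n by (intro ln_mono) auto
    finally show "mangoldt n \<le> ln (real Y)" .
  qed
  also have "\<dots> = real (card ?A) * ln (real Y)" by simp
  also have "\<dots> \<le> sqrt (real Y) * (2 * ln (real Y)) * ln (real Y)"
    using cardA False by (intro mult_right_mono) auto
  finally show ?thesis by (simp add: power2_eq_square mult_ac)
qed simp

text \<open>
  Partial summation; the factor in front of \<open>M\<close> is at most twice the largest value if \<open>w\<close> is nonnegative and monotone.
\<close>

lemma norm_abel_sum_le: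
  fixes w :: "nat \<Rightarrow> real" and g :: "nat \<Rightarrow> complex"
  assumes "\<And>j. j \<le> K \<Longrightarrow> norm (\<Sum>k = 1..j. g k) \<le> M"
  shows "norm (\<Sum>k = 1..K. of_real (w k) * g k) \<le> (\<bar>w K\<bar> + (\<Sum>k = 1..<K. \<bar>w (Suc k) - w k\<bar>)) * M"
proof -
  define S where "S j = (\<Sum>k = 1..j. g k)" for j
  have "(\<Sum>k = 1..K. of_real (w k) * g k) = of_real (w K) * S K - (\<Sum>k = 1..<K. of_real (w (Suc k) - w k) * S k)"
  proof (induction K)
    case (Suc K)
    show ?case
    proof (cases "K = 0")
      case False
      then have "(\<Sum>k = 1..<Suc K. of_real (w (Suc k) - w k) * S k) =
          (\<Sum>k = 1..<K. of_real (w (Suc k) - w k) * S k) + of_real (w (Suc K) - w K) * S K"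
        by simp
      moreover have "S (Suc K) = S K + g (Suc K)" by (simp add: S_def)
      ultimately show ?thesis using Suc False by (simp add: algebra_simps)
    qed (simp add: S_def)
  qed (simp add: S_def)
  also have "norm \<dots> \<le> norm (of_real (w K) * S K) + norm (\<Sum>k = 1..<K. of_real (w (Suc k) - w k) * S k)"
    by (rule norm_triangle_ineq4)
  also have "\<dots> \<le> \<bar>w K\<bar> * M + (\<Sum>k = 1..<K. \<bar>w (Suc k) - w k\<bar> * M)"
    using assms unfolding S_def
    by (intro add_mono sum_norm_le) (auto simp: norm_mult simp flip: of_real_diff intro!: mult_left_mono)
  finally show ?thesis by (simp add: distrib_right sum_distrib_right)
qed

section \<open>Kloosterman sums over primes\<close>

text \<open>
  Since \<open>x \<le> y\<close>, exponents may be moved from \<open>x\<close> to \<open>y\<close>. This serves to compare products of powers of \<open>X\<close>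
  and \<open>q\<close> in the range \<open>1 \<le> X \<le> q\<close>.
\<close>

lemma powr_tradeoff:
  fixes x y :: real
  assumes "1 \<le> x" "x \<le> y" "c \<le> a" "a + b \<le> c + d"
  shows "x powr a * y powr b \<le> x powr c * y powr d"
proof -
  have "x powr a * y powr b = x powr c * (x powr (a - c) * y powr b)"
    using assms by (simp add: powr_add[symmetric] mult.assoc[symmetric])
  also have "\<dots> \<le> x powr c * (y powr (a - c) * y powr b)"
    using assms by (intro mult_left_mono mult_right_mono powr_mono2) auto
  also have "y powr (a - c) * y powr b = y powr (a - c + b)"
    by (simp add: powr_add)
  also have "x powr c * y powr (a - c + b) \<le> x powr c * y powr d"
    using assms by (intro mult_left_mono powr_mono) auto
  finally show ?thesis .
qed

text \<open>
  The setting for the bound on the sum of \<open>e(b/p)\<close> over the primes \<open>p \<le> X\<close>. The assumption \<open>cut_ge_1\<close> says that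
  the parameter of Vaughan's identity is at least \<open>1\<close>, that is, \<open>X \<ge> q^(4/5)\<close>. The bound \<open>9 * q ^ 2\<close> covers the
  integers factored in \<open>card_inv_sum_reps_nonzero_le\<close>.
\<close>

locale prime_kloosterman =
  fixes q :: nat and b :: int and X L :: real
  assumes prime_q: "prime q"
    and b_unit: "\<not> int q dvd b"
    and X_pos: "0 < X"
    and X_less: "X < real q"
    and cut_ge_1: "1 \<le> X powr (5 / 6) * real q powr (- 2 / 3)"
    and log_le: "2 + ln (real q) \<le> L"
    and divisors_le: "\<And>n. 0 < n \<Longrightarrow> n \<le> 9 * q ^ 2 \<Longrightarrow> real (card {d. d dvd n}) \<le> L"
begin

definition U :: real where "U = X powr (5 / 6) * real q powr (- 2 / 3)"

definition u :: nat where "u = nat \<lfloor>U\<rfloor>"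

text \<open>
  The bound aimed at, without powers of \<open>L\<close>.
\<close>

definition Q :: real where "Q = X powr (25 / 32) * real q powr (3 / 16)"

definition F :: "nat \<Rightarrow> complex" where "F n = add_char q (b * mod_inv q n)"

lemma q_gt_1: "q > 1"
  using prime_gt_1_nat[OF prime_q] .

lemma X_ge_1: "1 \<le> X"
proof (rule ccontr)
  assume "\<not> 1 \<le> X"
  then have "X powr (5 / 6) \<le> 1 powr (5 / 6)"
    using X_pos by (intro powr_mono2) auto
  then have "X powr (5 / 6) * real q powr (- 2 / 3) \<le> 1 * real q powr (- 2 / 3)"
    by (intro mult_right_mono) auto
  also have "\<dots> < real q powr 0"
    using q_gt_1 by (simp only: mult_1, intro powr_less_mono) auto
  finally show False using cut_ge_1 q_gt_1 by simp
qed

lemma U_ge_1: "1 \<le> U"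
  using cut_ge_1 by (simp add: U_def)

lemma u_le: "real u \<le> U"
  using U_ge_1 by (simp add: u_def of_nat_nat)

lemma U_less: "U < real u + 1"
  using U_ge_1 by (simp add: u_def)

lemma u_pos: "u > 0"
  using U_ge_1 by (simp add: u_def)

lemma Q_nonneg: "0 \<le> Q"
  by (simp add: Q_def)

lemma L_ge_2: "2 \<le> L"
  using log_le q_gt_1 ln_ge_zero[of "real q"] by linarith

lemma ln_le_L:
  assumes "n \<le> q"
  shows "ln (real n) \<le> L"
proof (cases "n = 0")
  case False
  then have "ln (real n) \<le> ln (real q)" using assms by (intro ln_mono) auto
  then show ?thesis using log_le by linarith
qed (use L_ge_2 in simp)

lemma norm_F [simp]: "norm (F n) = 1"
  by (simp add: F_def)

lemma F_mult: "F (m * n) = add_char q (b * mod_inv q m * mod_inv q n)"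
  by (simp add: F_def mod_inv_mult mult.assoc)

text \<open>
  A sum of type I consists of at most \<open>U\<close> incomplete Kloosterman sums, so up to powers of \<open>L\<close> its trivial
  estimate over the outer variable is admissible.
\<close>

lemma U_mult_kloosterman_le: "U * real q powr (3 / 4) \<le> Q"
proof -
  have "U * real q powr (3 / 4) = X powr (5 / 6) * real q powr (1 / 12)"
    by (simp add: U_def powr_add[symmetric] mult.assoc)
  also have "\<dots> \<le> Q"
    unfolding Q_def using X_ge_1 X_less by (intro powr_tradeoff) auto
  finally show ?thesis .
qed

lemma U_le_Q: "U \<le> Q"
proof -
  have "U * 1 \<le> U * real q powr (3 / 4)"
    using U_ge_1 q_gt_1 by (intro mult_left_mono ge_one_powr_ge_zero) auto
  with U_mult_kloosterman_le show ?thesis by simp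
qed

lemma u_mult_kloosterman_le: "real u * real q powr (3 / 4) \<le> Q"
  using mult_right_mono[OF u_le, of "real q powr (3 / 4)"] U_mult_kloosterman_le by simp

lemma u_lt_q: "u < q"
proof -
  have "U = X powr (5 / 6) * real q powr (- 2 / 3)" by (simp add: U_def)
  also have "\<dots> \<le> X powr 0 * real q powr (1 / 6)"
    using X_ge_1 X_less by (intro powr_tradeoff) auto
  also have "\<dots> = real q powr (1 / 6)"
    using X_ge_1 by simp
  also have "\<dots> < real q powr 1"
    using q_gt_1 by (intro powr_less_mono) auto
  finally show ?thesis using u_le q_gt_1 by simp
qed

lemma U_cubed: "U ^ 3 = X powr (5 / 2) * real q powr (- 2)"
  using X_ge_1 q_gt_1 by (simp add: U_def power_mult_distrib powr_power)

lemma U_cubed_le_Q: "U ^ 3 \<le> Q"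
  unfolding U_cubed Q_def using X_ge_1 X_less by (intro powr_tradeoff) auto

lemma sqrt_X_le_Q: "sqrt X \<le> Q"
proof -
  have "sqrt X = X powr (1 / 2) * 1"
    using X_ge_1 by (simp add: powr_half_sqrt)
  also have "\<dots> \<le> Q"
    unfolding Q_def using X_ge_1 q_gt_1
    by (intro mult_mono powr_mono ge_one_powr_ge_zero) auto
  finally show ?thesis .
qed

lemma Q_power_8: "Q ^ 8 = X powr (25 / 4) * real q powr (3 / 2)"
  using X_ge_1 q_gt_1 by (simp add: Q_def power_mult_distrib powr_power)

lemma energy_factor_le:
  fixes K :: real
  assumes "0 \<le> K" "K * U \<le> 2 * X"
  shows "sqrt (K ^ 3 / real q) \<le> 3 * (X powr (1 / 4) * real q powr (1 / 2))"
proof (rule real_le_lsqrt)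
  have "(K * U) ^ 3 \<le> (2 * X) ^ 3"
    using assms U_ge_1 by (intro power_mono) auto
  then have "K ^ 3 * U ^ 3 \<le> 8 * X ^ 3"
    by (simp add: power_mult_distrib)
  also have "X ^ 3 = X powr 3" using X_ge_1 by simp
  also have "\<dots> = X powr (1 / 2) * real q powr 2 * U ^ 3"
  proof -
    have "X powr (1 / 2) * real q powr 2 * U ^ 3 =
        (X powr (1 / 2) * X powr (5 / 2)) * (real q powr 2 * real q powr (- 2))"
      unfolding U_cubed by (simp only: mult_ac)
    also have "\<dots> = X powr 3"
      unfolding powr_add[symmetric] using q_gt_1 by simp
    finally show ?thesis ..
  qed
  also have "8 * \<dots> = (8 * (X powr (1 / 2) * real q powr 2)) * U ^ 3" by simp
  finally have "K ^ 3 \<le> 8 * (X powr (1 / 2) * real q powr 2)"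
    using U_ge_1 by (subst (asm) mult_le_cancel_right_pos) auto
  then have "K ^ 3 / real q \<le> 8 * (X powr (1 / 2) * real q powr 2) / real q"
    by (intro divide_right_mono) auto
  also have "\<dots> = 8 * (X powr (1 / 2) * real q)"
    using q_gt_1 by (simp add: powr_numeral power2_eq_square)
  also have "\<dots> \<le> 9 * (X powr (1 / 2) * real q)"
    by (intro mult_right_mono) auto
  also have "\<dots> = (3 * (X powr (1 / 4) * real q powr (1 / 2))) ^ 2"
    using q_gt_1 X_ge_1 by (simp add: power_mult_distrib powr_power)
  finally show "K ^ 3 / real q \<le> (3 * (X powr (1 / 4) * real q powr (1 / 2))) ^ 2" .
qed auto

text \<open>
  The factors from the two energies multiply to \<open>1\<close>, one term for each variable, and one for the product. Each
  variable is at most \<open>2 X/U\<close>, as the other one is at least \<open>U\<close>, and the definition of \<open>U\<close> makes the two middle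
  terms at most a constant times \<open>X^(1/4) q^(1/2)\<close>, the loss that \<open>rectangle_bound\<close> can tolerate.
\<close>

lemma energy_factors_product_le:
  fixes K1 K2 :: real
  assumes "U \<le> K1" "U \<le> K2" "K1 * K2 \<le> 2 * X"
  shows "(1 + sqrt (K1 ^ 3 / real q)) * (1 + sqrt (K2 ^ 3 / real q)) \<le> 10 * (X powr (1 / 4) * real q powr (1 / 2))"
proof -
  define z where "z = X powr (1 / 4) * real q powr (1 / 2)"
  have z1: "1 \<le> z"
    unfolding z_def using X_ge_1 q_gt_1 mult_mono[of 1 "X powr (1/4)" 1 "real q powr (1 / 2)"]
    by (simp add: ge_one_powr_ge_zero)
  have pos: "0 < K1" "0 < K2" using assms U_ge_1 by linarith+
  have 1: "sqrt (K1 ^ 3 / real q) \<le> 3 * z" unfolding z_def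
  proof (rule energy_factor_le)
    have "K1 * U \<le> K1 * K2" using assms pos by (intro mult_left_mono) auto
    then show "K1 * U \<le> 2 * X" using assms by linarith
  qed (use pos in auto)
  have 2: "sqrt (K2 ^ 3 / real q) \<le> 3 * z" unfolding z_def
  proof (rule energy_factor_le)
    have "K2 * U \<le> K2 * K1" using assms pos by (intro mult_left_mono) auto
    then show "K2 * U \<le> 2 * X" using assms by (simp add: mult.commute)
  qed (use pos in auto)
  have "sqrt (K1 ^ 3 / real q) * sqrt (K2 ^ 3 / real q) = sqrt ((K1 * K2) ^ 3 / real q ^ 2)"
    by (simp add: real_sqrt_mult[symmetric] power_mult_distrib power2_eq_square)
  also have "\<dots> \<le> 3 * z"
  proof (rule real_le_lsqrt)
    have "(K1 * K2) ^ 3 \<le> (2 * X) ^ 3"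
      using assms pos by (intro power_mono) auto
    also have "\<dots> = 8 * X powr 3" using X_ge_1 by (simp add: power_mult_distrib)
    finally have "(K1 * K2) ^ 3 / real q ^ 2 \<le> 8 * X powr 3 / real q ^ 2"
      by (intro divide_right_mono) auto
    also have "\<dots> = 8 * (X powr 3 * real q powr (- 2))"
      using q_gt_1 by (simp add: powr_minus divide_inverse)
    also have "\<dots> \<le> 9 * (X powr (1 / 2) * real q powr 1)"
      using X_ge_1 X_less by (intro mult_mono powr_tradeoff) auto
    also have "\<dots> = (3 * z) ^ 2"
      using q_gt_1 X_ge_1 by (simp add: z_def power_mult_distrib powr_power)
    finally show "(K1 * K2) ^ 3 / real q ^ 2 \<le> (3 * z) ^ 2" .
  qed (use z1 in auto)
  finally have "sqrt (K1 ^ 3 / real q) * sqrt (K2 ^ 3 / real q) \<le> 3 * z" .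
  with 1 2 z1 have "(1 + sqrt (K1 ^ 3 / real q)) * (1 + sqrt (K2 ^ 3 / real q)) \<le> 10 * z"
    by (simp add: algebra_simps)
  then show ?thesis by (simp add: z_def)
qed

text \<open>
  The eighth power of the sum is at most \<open>(K1 K2)^4 q\<close> times the two energies, hence up to constants and \<open>L\<close> at most
  \<open>X^6 q (X^(1/4) q^(1/2)) = Q^8\<close>.
\<close>

lemma rectangle_bound:
  assumes "finite S" "S \<subseteq> {1..K1}" "K1 < q" "K2 < q" "u < K1" "u < K2" "real K1 * real K2 \<le> 2 * X"
    and "\<And>m. m \<in> S \<Longrightarrow> norm (\<alpha> m) \<le> A" "\<And>n. n \<in> {1..K2} \<Longrightarrow> norm (\<beta> n) \<le> B" "0 \<le> A" "0 \<le> B"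
  shows "norm (\<Sum>m\<in>S. \<Sum>n = 1..K2. \<alpha> m * \<beta> n * F (m * n)) \<le> 5 * A * B * L * Q"
proof -
  define P where "P = real K1 * real K2"
  define z where "z = X powr (1 / 4) * real q powr (1 / 2)"
  have z0: "z \<ge> 0" by (simp add: z_def)
  have L0: "L \<ge> 1" using L_ge_2 by simp
  have P: "0 \<le> P" "P \<le> 2 * X" using assms by (auto simp: P_def)
  have U1: "U \<le> real K1" "U \<le> real K2"
    using U_less assms(5,6) by linarith+
  have cardS: "card S \<le> K1" using card_mono[OF _ assms(2)] by simp
  have E1: "real (inv_energy q S) \<le> 16 * L * real K1 ^ 2 * (1 + sqrt (real K1 ^ 3 / real q))"
    using assms by (intro inv_energy_le prime_q divisors_le) auto
  have E2: "real (inv_energy q {1..K2}) \<le> 16 * L * real K2 ^ 2 * (1 + sqrt (real K2 ^ 3 / real q))"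
    using assms by (intro inv_energy_le prime_q divisors_le) auto
  have "real (inv_energy q S) * real (inv_energy q {1..K2}) \<le>
      (16 * L * real K1 ^ 2 * (1 + sqrt (real K1 ^ 3 / real q))) * (16 * L * real K2 ^ 2 * (1 + sqrt (real K2 ^ 3 / real q)))"
    using L0 by (intro mult_mono E1 E2) auto
  also have "\<dots> = 256 * L ^ 2 * P ^ 2 * ((1 + sqrt (real K1 ^ 3 / real q)) * (1 + sqrt (real K2 ^ 3 / real q)))"
  proof -
    have "(16 * L * x ^ 2 * s) * (16 * L * y ^ 2 * t) = 256 * L ^ 2 * (x * y) ^ 2 * (s * t)" for x y s t :: real
      by (simp add: power2_eq_square)
    then show ?thesis by (simp only: P_def)
  qed
  also have "\<dots> \<le> 256 * L ^ 2 * P ^ 2 * (10 * z)"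
    unfolding z_def using U1 assms(7) by (intro mult_left_mono energy_factors_product_le) auto
  finally have E: "real (inv_energy q S) * real (inv_energy q {1..K2}) \<le> 256 * L ^ 2 * P ^ 2 * (10 * z)" .
  have "norm (\<Sum>m\<in>S. \<Sum>n = 1..K2. \<alpha> m * \<beta> n * F (m * n)) ^ 8 \<le>
      (A * B) ^ 8 * (real (card S) * real (card {1..K2})) ^ 4 * (real q * inv_energy q S * inv_energy q {1..K2})"
    unfolding F_mult using assms by (intro bilinear_bound prime_q b_unit) auto
  also have "\<dots> \<le> (A * B) ^ 8 * P ^ 4 * (real q * (256 * L ^ 2 * P ^ 2 * (10 * z)))"
  proof -
    have "real (card S) * real (card {1..K2}) \<le> P"
      using cardS by (simp add: P_def mult_right_mono)
    then have c: "(real (card S) * real (card {1..K2})) ^ 4 \<le> P ^ 4"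
      by (intro power_mono) auto
    have e: "real q * inv_energy q S * inv_energy q {1..K2} \<le> real q * (256 * L ^ 2 * P ^ 2 * (10 * z))"
      using E by (simp only: mult.assoc[of "real q"]) (intro mult_left_mono, auto)
    have "(A * B) ^ 8 * (real (card S) * real (card {1..K2})) ^ 4 \<le> (A * B) ^ 8 * P ^ 4"
      using c assms(10,11) by (intro mult_left_mono) auto
    from mult_mono[OF this e] show ?thesis
      using assms(10,11) by simp
  qed
  also have "\<dots> = (A * B) ^ 8 * 2560 * L ^ 2 * P ^ 6 * (real q * z)"
    by (simp add: power_add[of P 4 2, simplified] mult_ac)
  also have "\<dots> \<le> (A * B) ^ 8 * 2560 * L ^ 8 * (2 * X) ^ 6 * (real q * z)"
    using P L0 assms(10,11) z0 X_ge_1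
    by (intro mult_mono power_mono power_increasing mult_nonneg_nonneg) auto
  also have "\<dots> = (A * B * L) ^ 8 * 163840 * (X ^ 6 * real q * z)"
    by (simp add: power_mult_distrib mult_ac)
  also have "X ^ 6 * real q * z = Q ^ 8"
  proof -
    have "X ^ 6 * real q * z = (X powr 6 * X powr (1 / 4)) * (real q powr 1 * real q powr (1 / 2))"
      using X_ge_1 q_gt_1 by (simp add: z_def)
    also have "\<dots> = Q ^ 8"
      unfolding Q_power_8 powr_add[symmetric] by simp
    finally show ?thesis .
  qed
  also have "(A * B * L) ^ 8 * 163840 * Q ^ 8 \<le> (A * B * L) ^ 8 * 390625 * Q ^ 8"
    using Q_nonneg by (intro mult_right_mono mult_left_mono) auto
  also have "\<dots> = (5 * A * B * L * Q) ^ 8"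
    by (simp add: power_mult_distrib)
  finally show ?thesis
    using assms(10,11) L0 Q_nonneg by (subst (asm) power_mono_iff) auto
qed

text \<open>
  Completion replaces the condition \<open>m n \<le> Y\<close> by \<open>n \<le> Y/M\<close>. For \<open>m\<close> in the block this is a rectangle of area at most
  \<open>2 Y\<close>, so nothing but a factor \<open>L\<close> is lost.
\<close>

lemma dyadic_block_bound:
  assumes "M > 0" "S \<subseteq> {M..<2 * M}" "S \<subseteq> {u<..W}" "W * (u + 1) \<le> Y" "real Y \<le> X"
    and "\<And>m. m \<in> S \<Longrightarrow> norm (\<alpha> m) \<le> A" "\<And>n. n \<in> {1..Y} \<Longrightarrow> norm (\<beta> n) \<le> B" "0 \<le> A" "0 \<le> B"
  shows "norm (\<Sum>m\<in>S. \<alpha> m * (\<Sum>n = 1..Y div m. \<beta> n * F (m * n))) \<le> 5 * A * B * L ^ 2 * Q"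
proof (cases "S = {}")
  case True
  have "0 \<le> 5 * A * B * L ^ 2 * Q" using assms(8,9) Q_nonneg by simp
  with True show ?thesis by simp
next
  case False
  then obtain m0 where m0: "m0 \<in> S" by blast
  define N where "N = Y div M"
  define K where "K = min (2 * M) Y"
  have Yq: "Y < q" using assms(5) X_less by linarith
  have finS: "finite S" using assms(2) finite_subset by blast
  have WY: "W \<le> Y" using assms(4) by (auto intro: order_trans[rotated])
  have SK: "S \<subseteq> {1..K}" using assms(1-3) WY by (fastforce simp: K_def)
  have "u < m0" "m0 \<le> K" using m0 assms(3) SK by auto
  then have uK: "u < K" by simp
  have "M \<le> m0" "m0 \<le> W" using m0 assms(2,3) by auto
  then have "M * (u + 1) \<le> Y"
    using assms(4) by (meson le_trans mult_le_mono1)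
  then have uN: "u < N"
    using assms(1) by (simp add: N_def less_eq_div_iff_mult_less_eq Suc_le_eq[symmetric] mult.commute)
  have NY: "N \<le> Y" by (simp add: N_def)
  have "K * N \<le> 2 * M * (Y div M)" by (simp add: K_def N_def)
  also have "\<dots> \<le> 2 * Y" by simp
  finally have "real (K * N) \<le> real (2 * Y)" by (simp only: of_nat_le_iff)
  then have KN: "real K * real N \<le> 2 * X" using assms(5) by simp
  have "(\<Sum>m\<in>S. \<alpha> m * (\<Sum>n = 1..Y div m. \<beta> n * F (m * n))) =
      (\<Sum>m\<in>S. \<Sum>n = 1..N. \<Sum>h<q. cut_coeff q (Y div m) h * add_char q (int h * int n) * (\<alpha> m * \<beta> n * F (m * n)))"
  proof (intro sum.cong refl)
    fix m assume m: "m \<in> S"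
    have mN: "Y div m \<le> N" unfolding N_def using m assms(1,2) by (intro div_le_mono2) auto
    have "\<alpha> m * (\<Sum>n = 1..Y div m. \<beta> n * F (m * n)) = (\<Sum>n = 1..Y div m. \<alpha> m * \<beta> n * F (m * n))"
      by (simp add: sum_distrib_left mult.assoc)
    also have "\<dots> = (\<Sum>n = 1..N. (if n \<in> {1..Y div m} then 1 else 0) * (\<alpha> m * \<beta> n * F (m * n)))"
      using mN by (intro sum.mono_neutral_cong_left) auto
    also have "\<dots> = (\<Sum>n = 1..N. \<Sum>h<q. cut_coeff q (Y div m) h * add_char q (int h * int n) * (\<alpha> m * \<beta> n * F (m * n)))"
      unfolding sum_distrib_right[symmetric]
      using mN NY Yq by (intro sum.cong refl) (subst cut_expansion, auto)
    finally show "\<alpha> m * (\<Sum>n = 1..Y div m. \<beta> n * F (m * n)) =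
        (\<Sum>n = 1..N. \<Sum>h<q. cut_coeff q (Y div m) h * add_char q (int h * int n) * (\<alpha> m * \<beta> n * F (m * n)))" .
  qed
  also have "\<dots> = (\<Sum>m\<in>S. \<Sum>h<q. \<Sum>n = 1..N. cut_coeff q (Y div m) h * add_char q (int h * int n) * (\<alpha> m * \<beta> n * F (m * n)))"
    by (intro sum.cong refl sum.swap)
  also have "\<dots> = (\<Sum>h<q. \<Sum>m\<in>S. \<Sum>n = 1..N. cut_coeff q (Y div m) h * add_char q (int h * int n) * (\<alpha> m * \<beta> n * F (m * n)))"
    by (rule sum.swap)
  also have "\<dots> = (\<Sum>h<q. \<Sum>m\<in>S. \<Sum>n = 1..N. (cut_coeff q (Y div m) h * \<alpha> m) * (\<beta> n * add_char q (int h * int n)) * F (m * n))"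
    by (intro sum.cong refl) (simp add: mult_ac)
  also have "norm \<dots> \<le> (\<Sum>h<q. cut_weight q h * (5 * A * B * L * Q))"
  proof (intro sum_norm_le)
    fix h assume h: "h \<in> {..<q}"
    have w0: "0 \<le> cut_weight q h" by (simp add: cut_weight_def)
    have "norm (\<Sum>m\<in>S. \<Sum>n = 1..N. (cut_coeff q (Y div m) h * \<alpha> m) * (\<beta> n * add_char q (int h * int n)) * F (m * n))
        \<le> 5 * (cut_weight q h * A) * B * L * Q"
    proof (rule rectangle_bound[OF finS SK _ _ uK uN KN])
      show "K < q" using Yq by (simp add: K_def)
      show "N < q" using NY Yq by simp
      show "norm (cut_coeff q (Y div m) h * \<alpha> m) \<le> cut_weight q h * A" if "m \<in> S" for m
      proof -
        have "Y div m < q" using Yq div_le_dividend le_less_trans by blast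
        then show ?thesis unfolding norm_mult
          using h that w0 by (intro mult_mono cut_coeff_bound assms(6)) auto
      qed
      show "norm (\<beta> n * add_char q (int h * int n)) \<le> B" if "n \<in> {1..N}" for n
        using assms(7)[of n] that NY by (simp add: norm_mult)
    qed (use assms(8,9) w0 in auto)
    then show "norm (\<Sum>m\<in>S. \<Sum>n = 1..N. (cut_coeff q (Y div m) h * \<alpha> m) * (\<beta> n * add_char q (int h * int n)) * F (m * n))
        \<le> cut_weight q h * (5 * A * B * L * Q)"
      by (simp add: mult_ac)
  qed
  also have "\<dots> = (\<Sum>h<q. cut_weight q h) * (5 * A * B * L * Q)"
    by (simp add: sum_distrib_right)
  also have "\<dots> \<le> L * (5 * A * B * L * Q)"
    using sum_cut_weight_le[of q] log_le q_gt_1 assms(8,9) Q_nonneg L_ge_2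
    by (intro mult_right_mono) auto
  also have "\<dots> = 5 * A * B * L ^ 2 * Q"
    by (simp add: power2_eq_square)
  finally show ?thesis .
qed

text \<open>
  The condition on \<open>W\<close> guarantees that the sum over \<open>n\<close> is longer than \<open>u\<close> for every \<open>m\<close>. There are at most
  \<open>2 L\<close> dyadic blocks.
\<close>

lemma type_II_bound:
  assumes "W * (u + 1) \<le> Y" "real Y \<le> X"
    and "\<And>m. m \<in> {u<..W} \<Longrightarrow> norm (\<alpha> m) \<le> A" "\<And>n. n \<in> {1..Y} \<Longrightarrow> norm (\<beta> n) \<le> B" "0 \<le> A" "0 \<le> B"
  shows "norm (\<Sum>m\<in>{u<..W}. \<alpha> m * (\<Sum>n = 1..Y div m. \<beta> n * F (m * n))) \<le> 10 * A * B * L ^ 3 * Q"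
proof (cases "Y = 0")
  case True
  have "0 \<le> 10 * A * B * L ^ 3 * Q" using assms Q_nonneg L_ge_2 by simp
  with True show ?thesis by simp
next
  case False
  let ?g = "\<lambda>m. \<alpha> m * (\<Sum>n = 1..Y div m. \<beta> n * F (m * n))"
  have WY: "W \<le> Y" using assms(1) by (auto intro: order_trans[rotated])
  have Yq: "Y \<le> q" using assms(2) X_less by linarith
  have "(\<Sum>m\<in>{u<..W}. ?g m) = (\<Sum>k\<le>floor_log Y. \<Sum>m | m \<in> {u<..W} \<and> floor_log m = k. ?g m)"
    using WY by (intro sum.group[symmetric]) (auto intro: floor_log_le_iff)
  also have "norm \<dots> \<le> (\<Sum>k\<le>floor_log Y. 5 * A * B * L ^ 2 * Q)"
  proof (intro sum_norm_le)
    fix k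
    show "norm (\<Sum>m | m \<in> {u<..W} \<and> floor_log m = k. ?g m) \<le> 5 * A * B * L ^ 2 * Q"
    proof (rule dyadic_block_bound[where M = "2 ^ k" and W = W])
      show "{m. m \<in> {u<..W} \<and> floor_log m = k} \<subseteq> {2 ^ k..<2 * 2 ^ k}"
        using floor_log_exp2_le floor_log_exp2_gt by auto
    qed (use assms in auto)
  qed
  also have "\<dots> = (real (floor_log Y) + 1) * (5 * A * B * L ^ 2 * Q)"
    by simp
  also have "\<dots> \<le> (2 * L) * (5 * A * B * L ^ 2 * Q)"
  proof (rule mult_right_mono)
    have "ln (real Y) \<le> ln (real q)" using False Yq by (intro ln_mono) auto
    then show "real (floor_log Y) + 1 \<le> 2 * L"
      using floor_log_le_2_ln[of Y] False log_le by linarith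
  qed (use assms Q_nonneg in auto)
  also have "\<dots> = 10 * A * B * L ^ 3 * Q"
    by (simp add: power2_eq_square power3_eq_cube)
  finally show ?thesis .
qed

lemma incomplete_bound:
  assumes "d \<in> {1..<q}" "K < q"
  shows "norm (\<Sum>k = 1..K. F (d * k)) \<le> 2 * L * real q powr (3 / 4)"
proof -
  have "\<not> q dvd d" using assms(1) by (auto dest: dvd_imp_le)
  then have "\<not> int q dvd b * mod_inv q d"
    using b_unit mod_inv_not_dvd[OF prime_q] prime_q by (simp add: prime_dvd_mult_iff)
  from incomplete_kloosterman_bound[OF prime_q this assms(2)]
  have "norm (\<Sum>k = 1..K. F (d * k)) \<le> 2 * (2 + ln (real q)) * real q powr (3 / 4)"
    by (simp add: F_mult)
  also have "\<dots> \<le> 2 * L * real q powr (3 / 4)"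
    using log_le by (intro mult_right_mono mult_left_mono) auto
  finally show ?thesis .
qed

text \<open>
  Partial summation, the weight being increasing.
\<close>

lemma incomplete_log_bound:
  assumes "d \<in> {1..<q}" "K < q"
  shows "norm (\<Sum>k = 1..K. of_real (ln (real k)) * F (d * k)) \<le> 4 * L ^ 2 * real q powr (3 / 4)"
proof (cases "K = 0")
  case False
  have "norm (\<Sum>k = 1..K. of_real (ln (real k)) * F (d * k)) \<le>
      (\<bar>ln (real K)\<bar> + (\<Sum>k = 1..<K. \<bar>ln (real (Suc k)) - ln (real k)\<bar>)) * (2 * L * real q powr (3 / 4))"
    using assms by (intro norm_abel_sum_le incomplete_bound) auto
  also have "(\<Sum>k = 1..<K. \<bar>ln (real (Suc k)) - ln (real k)\<bar>) = (\<Sum>k = 1..<K. ln (real (Suc k)) - ln (real k))"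
    by (intro sum.cong refl abs_of_nonneg) auto
  also have "\<dots> = ln (real K) - ln (real 1)"
    using False by (intro sum_Suc_diff') auto
  also have "\<bar>ln (real K)\<bar> + (ln (real K) - ln (real 1)) = 2 * ln (real K)"
    using False by simp
  also have "2 * ln (real K) * (2 * L * real q powr (3 / 4)) \<le> 2 * L * (2 * L * real q powr (3 / 4))"
    using ln_le_L[of K] assms(2) L_ge_2 by (intro mult_right_mono mult_left_mono) auto
  finally show ?thesis by (simp add: power2_eq_square)
qed simp

lemma type_I_log_bound:
  assumes "real Y \<le> X"
  shows "norm (\<Sum>d = 1..u. of_real (moebius d) * (\<Sum>k = 1..Y div d. of_real (ln (real k)) * F (d * k))) \<le> 4 * L ^ 2 * Q"
proof -
  have Yq: "Y < q" using assms X_less by linarith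
  have uq: "u < q" using u_lt_q .
  have "norm (\<Sum>d = 1..u. of_real (moebius d) * (\<Sum>k = 1..Y div d. of_real (ln (real k)) * F (d * k))) \<le>
      (\<Sum>d = 1..u. 4 * L ^ 2 * real q powr (3 / 4))"
  proof (intro sum_norm_le)
    fix d assume d: "d \<in> {1..u}"
    have "norm (\<Sum>k = 1..Y div d. of_real (ln (real k)) * F (d * k)) \<le> 4 * L ^ 2 * real q powr (3 / 4)"
      using d uq Yq by (intro incomplete_log_bound) (auto intro: le_less_trans[OF div_le_dividend])
    then have "\<bar>moebius d\<bar> * norm (\<Sum>k = 1..Y div d. of_real (ln (real k)) * F (d * k)) \<le> 1 * (4 * L ^ 2 * real q powr (3 / 4))"
      by (intro mult_mono abs_moebius_le) auto
    then show "norm (of_real (moebius d) * (\<Sum>k = 1..Y div d. of_real (ln (real k)) * F (d * k))) \<le> 4 * L ^ 2 * real q powr (3 / 4)"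
      by (simp add: norm_mult)
  qed
  also have "\<dots> = 4 * L ^ 2 * (real u * real q powr (3 / 4))" by simp
  also have "\<dots> \<le> 4 * L ^ 2 * Q"
    using u_mult_kloosterman_le by (intro mult_left_mono) auto
  finally show ?thesis .
qed

lemma type_I_low_bound:
  assumes "real Y \<le> X"
  shows "norm (\<Sum>d = 1..u. of_real (vaughan_low u d) * (\<Sum>k = 1..Y div d. F (d * k))) \<le> 2 * L ^ 2 * Q"
proof -
  have Yq: "Y < q" using assms X_less by linarith
  have uq: "u < q" using u_lt_q .
  have "norm (\<Sum>d = 1..u. of_real (vaughan_low u d) * (\<Sum>k = 1..Y div d. F (d * k))) \<le>
      (\<Sum>d = 1..u. L * (2 * L * real q powr (3 / 4)))"
  proof (intro sum_norm_le)
    fix d assume d: "d \<in> {1..u}"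
    have "norm (\<Sum>k = 1..Y div d. F (d * k)) \<le> 2 * L * real q powr (3 / 4)"
      using d uq Yq by (intro incomplete_bound) (auto intro: le_less_trans[OF div_le_dividend])
    moreover have "\<bar>vaughan_low u d\<bar> \<le> L"
      using abs_vaughan_low_le[of d u] ln_le_L[of d] d uq by auto
    ultimately show "norm (of_real (vaughan_low u d) * (\<Sum>k = 1..Y div d. F (d * k))) \<le> L * (2 * L * real q powr (3 / 4))"
      unfolding norm_mult norm_of_real using L_ge_2 by (intro mult_mono) auto
  qed
  also have "\<dots> = 2 * L ^ 2 * (real u * real q powr (3 / 4))" by (simp add: power2_eq_square)
  also have "\<dots> \<le> 2 * L ^ 2 * Q"
    using u_mult_kloosterman_le by (intro mult_left_mono) auto
  finally show ?thesis .
qed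

text \<open>
  Only \<open>d \<le> u^2\<close> occur, so the variable \<open>k\<close> runs up to \<open>Y/d > u\<close>.
\<close>

lemma type_II_low_bound:
  assumes "real Y \<le> X" "(u + 1) ^ 3 \<le> Y"
  shows "norm (\<Sum>d\<in>{u<..u ^ 2}. of_real (vaughan_low u d) * (\<Sum>k = 1..Y div d. F (d * k))) \<le> 10 * L ^ 4 * Q"
proof -
  have Yq: "Y < q" using assms X_less by linarith
  have "u ^ 2 * (u + 1) \<le> (u + 1) ^ 2 * (u + 1)"
    by (intro mult_right_mono power_mono) auto
  also have "\<dots> \<le> Y" using assms(2) by (simp add: power2_eq_square power3_eq_cube)
  finally have W: "u ^ 2 * (u + 1) \<le> Y" .
  have "norm (\<Sum>d\<in>{u<..u ^ 2}. of_real (vaughan_low u d) * (\<Sum>k = 1..Y div d. 1 * F (d * k))) \<le> 10 * L * 1 * L ^ 3 * Q"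
  proof (rule type_II_bound[OF W assms(1)])
    fix d assume d: "d \<in> {u<..u ^ 2}"
    have "u ^ 2 \<le> Y" using W by (auto intro: order_trans[rotated])
    then show "norm (complex_of_real (vaughan_low u d)) \<le> L"
      using abs_vaughan_low_le[of d u] ln_le_L[of d] d Yq by auto
  qed (use L_ge_2 in auto)
  also have "10 * L * 1 * L ^ 3 * Q = 10 * L ^ 4 * Q"
    by (simp add: eval_nat_numeral)
  finally show ?thesis by simp
qed

text \<open>
  Since the coefficients of \<open>m\<close> vanish for \<open>m \<le> u\<close>, only \<open>c \<le> Y / (u + 1)\<close> matter.
\<close>

lemma type_II_high_bound:
  assumes "real Y \<le> X"
  shows "norm (\<Sum>c\<in>{u<..Y}. of_real (mangoldt c) * (\<Sum>m = 1..Y div c. of_real (vaughan_high u m) * F (c * m))) \<le> 10 * L ^ 5 * Q"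
proof -
  have Yq: "Y < q" using assms X_less by linarith
  define W where "W = Y div (u + 1)"
  have WY: "W \<le> Y" by (simp add: W_def)
  have W: "W * (u + 1) \<le> Y" unfolding W_def by (rule div_times_less_eq_dividend)
  have "(\<Sum>c\<in>{u<..Y}. of_real (mangoldt c) * (\<Sum>m = 1..Y div c. of_real (vaughan_high u m) * F (c * m))) =
      (\<Sum>c\<in>{u<..W}. of_real (mangoldt c) * (\<Sum>m = 1..Y div c. of_real (vaughan_high u m) * F (c * m)))"
  proof (intro sum.mono_neutral_right ballI)
    fix c assume c: "c \<in> {u<..Y} - {u<..W}"
    then have "W < c" by auto
    then have "Y < c * (u + 1)"
      by (simp add: W_def div_less_iff_less_mult mult.commute)
    then have "Y div c \<le> u"
      using c by (simp add: div_less_iff_less_mult less_Suc_eq_le[symmetric] mult.commute)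
    then have "(\<Sum>m = 1..Y div c. of_real (vaughan_high u m) * F (c * m)) = 0"
      by (intro sum.neutral) (auto simp: vaughan_high_eq_0)
    then show "of_real (mangoldt c) * (\<Sum>m = 1..Y div c. of_real (vaughan_high u m) * F (c * m)) = 0" by simp
  qed (use WY in auto)
  also have "norm \<dots> \<le> 10 * L * L * L ^ 3 * Q"
  proof (rule type_II_bound[OF W assms])
    fix c assume c: "c \<in> {u<..W}"
    have "mangoldt c \<le> ln (real c)" using c by (intro mangoldt_le) auto
    also have "\<dots> \<le> L" using c WY Yq by (intro ln_le_L) auto
    finally show "norm (complex_of_real (mangoldt c)) \<le> L" by simp
  next
    fix m assume m: "m \<in> {1..Y}"
    have "q \<le> q ^ 2" using q_gt_1 by (simp add: power2_eq_square)
    with m Yq have "real (card {d. d dvd m}) \<le> L" by (intro divisors_le) auto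
    then show "norm (complex_of_real (vaughan_high u m)) \<le> L"
      using abs_vaughan_high_le[of m u] m by simp
  qed (use L_ge_2 in auto)
  also have "10 * L * L * L ^ 3 * Q = 10 * L ^ 5 * Q"
    by (simp add: eval_nat_numeral)
  finally show ?thesis .
qed

lemma sum_mangoldt_le:
  assumes "Y \<le> q"
  shows "norm (\<Sum>n = 1..Y. of_real (mangoldt n) * F n) \<le> real Y * L"
proof -
  have "norm (\<Sum>n = 1..Y. of_real (mangoldt n) * F n) \<le> (\<Sum>n = 1..Y. L)"
  proof (intro sum_norm_le)
    fix n assume n: "n \<in> {1..Y}"
    have "mangoldt n \<le> ln (real n)" using n by (intro mangoldt_le) auto
    also have "\<dots> \<le> L" using n assms by (intro ln_le_L) auto
    finally show "norm (of_real (mangoldt n) * F n) \<le> L" by (simp add: norm_mult)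
  qed
  then show ?thesis by simp
qed

lemma mangoldt_sum_bound:
  assumes "real Y \<le> X"
  shows "norm (\<Sum>n = 1..Y. of_real (mangoldt n) * F n) \<le> 27 * L ^ 5 * Q"
proof (cases "(u + 1) ^ 3 \<le> Y")
  case False
  \<comment> \<open>The sum is so short that the trivial bound suffices.\<close>
  have "real Y * L \<le> (8 * U ^ 3) * L"
  proof (intro mult_right_mono)
    have "real Y \<le> real ((u + 1) ^ 3)" using False by (simp only: of_nat_le_iff)
    also have "\<dots> = (real u + 1) ^ 3" by (simp add: add.commute)
    also have "\<dots> \<le> (2 * U) ^ 3" using u_le U_ge_1 by (intro power_mono) auto
    finally show "real Y \<le> 8 * U ^ 3" by (simp add: power_mult_distrib)
  qed (use L_ge_2 in auto)
  also have "\<dots> \<le> (27 * Q) * L ^ 5"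
    using U_cubed_le_Q Q_nonneg U_ge_1 L_ge_2 by (intro mult_mono self_le_power) auto
  finally have "real Y * L \<le> 27 * L ^ 5 * Q" by (simp add: mult_ac)
  moreover have "Y \<le> q" using assms X_less by linarith
  ultimately show ?thesis using sum_mangoldt_le order_trans by blast
next
  case True
  have "u + 1 \<le> (u + 1) ^ 3" by (intro self_le_power) auto
  with True have uY: "u \<le> Y" by linarith
  have uu: "u \<le> u ^ 2" using u_pos by (simp add: power2_eq_square)
  let ?low = "\<lambda>d. of_real (vaughan_low u d) * (\<Sum>k = 1..Y div d. F (d * k))"
  have "{1..u ^ 2} = {1..u} \<union> {u<..u ^ 2}" using uu by auto
  then have low: "(\<Sum>d = 1..u ^ 2. ?low d) = (\<Sum>d = 1..u. ?low d) + (\<Sum>d\<in>{u<..u ^ 2}. ?low d)"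
    by (simp only:) (rule sum.union_disjoint, auto)
  have "{1..Y} = {1..u} \<union> {u<..Y}" using uY by auto
  then have "(\<Sum>n = 1..Y. of_real (mangoldt n) * F n) =
      (\<Sum>n = 1..u. of_real (mangoldt n) * F n) + (\<Sum>n\<in>{u<..Y}. of_real (mangoldt n) * F n)"
    by (simp only:) (rule sum.union_disjoint, auto)
  also have "\<dots> = (\<Sum>n = 1..u. of_real (mangoldt n) * F n) +
     ((\<Sum>d = 1..u. of_real (moebius d) * (\<Sum>k = 1..Y div d. of_real (ln (real k)) * F (d * k)))
     - ((\<Sum>d = 1..u. ?low d) + (\<Sum>d\<in>{u<..u ^ 2}. ?low d))
     + (\<Sum>c\<in>{u<..Y}. of_real (mangoldt c) * (\<Sum>m = 1..Y div c. of_real (vaughan_high u m) * F (c * m))))"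
    by (simp only: vaughan_identity[where F = F and u = u and Y = Y] low)
  finally have eq: "(\<Sum>n = 1..Y. of_real (mangoldt n) * F n) = (\<Sum>n = 1..u. of_real (mangoldt n) * F n) +
     ((\<Sum>d = 1..u. of_real (moebius d) * (\<Sum>k = 1..Y div d. of_real (ln (real k)) * F (d * k)))
     - ((\<Sum>d = 1..u. ?low d) + (\<Sum>d\<in>{u<..u ^ 2}. ?low d))
     + (\<Sum>c\<in>{u<..Y}. of_real (mangoldt c) * (\<Sum>m = 1..Y div c. of_real (vaughan_high u m) * F (c * m))))" .
  have tri: "norm (a + (b - (c + d) + e)) \<le> norm a + norm b + norm c + norm d + norm e" for a b c d e :: complex
    by norm
  have "norm (\<Sum>n = 1..Y. of_real (mangoldt n) * F n) \<le>
      L * Q + 4 * L ^ 2 * Q + 2 * L ^ 2 * Q + 10 * L ^ 4 * Q + 10 * L ^ 5 * Q"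
    unfolding eq
  proof (rule order_trans[OF tri], intro add_mono)
    have "real u * L \<le> Q * L"
      using u_le U_le_Q L_ge_2 by (intro mult_right_mono) auto
    then show "norm (\<Sum>n = 1..u. of_real (mangoldt n) * F n) \<le> L * Q"
      using sum_mangoldt_le[of u] u_lt_q by (simp add: mult.commute)
  qed (intro type_I_log_bound type_I_low_bound type_II_low_bound type_II_high_bound assms True)+
  also have "\<dots> = (L ^ 1 + 6 * L ^ 2 + 10 * L ^ 4 + 10 * L ^ 5) * Q"
    by (simp add: algebra_simps)
  also have "\<dots> \<le> (L ^ 5 + 6 * L ^ 5 + 10 * L ^ 5 + 10 * L ^ 5) * Q"
    using L_ge_2 Q_nonneg by (intro mult_right_mono add_mono mult_left_mono power_increasing) auto
  finally show ?thesis by simp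
qed

lemma prime_log_sum_bound:
  assumes "real Y \<le> X"
  shows "norm (\<Sum>n = 1..Y. (if prime n then of_real (ln (real n)) * F n else 0)) \<le> 29 * L ^ 5 * Q"
proof (cases "Y = 0")
  case True
  then show ?thesis using Q_nonneg L_ge_2 by simp
next
  case False
  have Yq: "Y \<le> q" using assms X_less by linarith
  let ?N = "{n. n \<in> {1..Y} \<and> \<not> prime n}"
  have "(\<Sum>n = 1..Y. (if prime n then of_real (ln (real n)) * F n else 0)) =
      (\<Sum>n = 1..Y. of_real (mangoldt n) * F n - (if \<not> prime n then of_real (mangoldt n) * F n else 0))"
    by (intro sum.cong refl) auto
  also have "\<dots> = (\<Sum>n = 1..Y. of_real (mangoldt n) * F n) - (\<Sum>n\<in>?N. of_real (mangoldt n) * F n)"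
    by (simp only: sum_subtractf) (subst sum.inter_filter, auto)
  also have "norm \<dots> \<le> norm (\<Sum>n = 1..Y. of_real (mangoldt n) * F n) + norm (\<Sum>n\<in>?N. of_real (mangoldt n) * F n)"
    by (rule norm_triangle_ineq4)
  also have "\<dots> \<le> 27 * L ^ 5 * Q + 2 * L ^ 5 * Q"
  proof (intro add_mono mangoldt_sum_bound assms)
    have "norm (\<Sum>n\<in>?N. of_real (mangoldt n) * F n) \<le> (\<Sum>n\<in>?N. mangoldt n)"
      by (intro sum_norm_le) (simp add: norm_mult)
    also have "\<dots> \<le> 2 * sqrt (real Y) * ln (real Y) ^ 2"
      by (rule sum_mangoldt_prime_powers_le)
    also have "\<dots> \<le> 2 * Q * L ^ 5"
    proof (intro mult_mono)
      show "sqrt (real Y) \<le> Q"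
        using sqrt_X_le_Q assms real_sqrt_le_mono order_trans by blast
      have "ln (real Y) ^ 2 \<le> L ^ 2" using ln_le_L[OF Yq] False by (intro power_mono) auto
      also have "\<dots> \<le> L ^ 5" using L_ge_2 by (intro power_increasing) auto
      finally show "ln (real Y) ^ 2 \<le> L ^ 5" .
    qed (use Q_nonneg in auto)
    finally show "norm (\<Sum>n\<in>?N. of_real (mangoldt n) * F n) \<le> 2 * L ^ 5 * Q" by (simp add: mult_ac)
  qed
  also have "\<dots> = 29 * L ^ 5 * Q" by simp
  finally show ?thesis .
qed

lemma prime_sum_bound:
  "norm (\<Sum>p\<in>primes_upto X. F p) \<le> 58 * L ^ 5 * Q"
proof -
  define Y where "Y = nat \<lfloor>X\<rfloor>"
  have Y: "real Y \<le> X" using X_pos by (simp add: Y_def of_nat_nat)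
  have Y0: "Y > 0" using X_ge_1 by (simp add: Y_def)
  have P: "primes_upto X = {p \<in> {1..Y}. prime p}"
    using X_pos by (auto simp: primes_upto_def Y_def le_nat_floor prime_gt_0_nat Suc_le_eq)
      (metis Y Y_def of_nat_le_iff order_trans)
  \<comment> \<open>Partial summation removes the weight \<open>ln p\<close>. The maximum only serves to define
    a decreasing weight also at \<open>1\<close>.\<close>
  define w where "w n = 1 / ln (real (max 2 n))" for n
  define g where "g n = (if prime n then of_real (ln (real n)) * F n else 0)" for n
  have w_mono: "w (Suc n) \<le> w n" for n
    unfolding w_def by (intro divide_left_mono mult_pos_pos ln_mono ln_gt_zero) auto
  have "(\<Sum>p\<in>primes_upto X. F p) = (\<Sum>n = 1..Y. of_real (w n) * g n)"
    unfolding P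
  proof (rule sum.mono_neutral_cong_left)
    fix n assume n: "n \<in> {p \<in> {1..Y}. prime p}"
    then have "n \<ge> 2" using prime_ge_2_nat by simp
    with n show "F n = of_real (w n) * g n"
      by (simp add: w_def g_def max_def flip: of_real_mult)
  qed (auto simp: g_def)
  also have "norm \<dots> \<le> (\<bar>w Y\<bar> + (\<Sum>k = 1..<Y. \<bar>w (Suc k) - w k\<bar>)) * (29 * L ^ 5 * Q)"
  proof (intro norm_abel_sum_le)
    fix j assume "j \<le> Y"
    then have "real j \<le> X" using Y by linarith
    then show "norm (\<Sum>k = 1..j. g k) \<le> 29 * L ^ 5 * Q"
      unfolding g_def by (rule prime_log_sum_bound)
  qed
  also have "(\<Sum>k = 1..<Y. \<bar>w (Suc k) - w k\<bar>) = (\<Sum>k = 1..<Y. - (w (Suc k) - w k))"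
    using w_mono by (intro sum.cong refl abs_of_nonpos) auto
  also have "\<dots> = - (w Y - w 1)"
    unfolding sum_negf using Y0 by (subst sum_Suc_diff') auto
  also have "\<bar>w Y\<bar> + - (w Y - w 1) = 1 / ln 2"
    by (simp add: w_def max_def)
  also have "1 / ln 2 * (29 * L ^ 5 * Q) \<le> 2 * (29 * L ^ 5 * Q)"
  proof (rule mult_right_mono)
    show "1 / ln 2 \<le> (2::real)" using ln2_ge_two_thirds by (simp add: field_simps)
  qed (use Q_nonneg L_ge_2 in auto)
  finally show ?thesis by simp
qed

end

section \<open>Counting triples of primes\<close>

text \<open>
  The circle method modulo \<open>q\<close> for \<open>p2 + p3 = a/p1\<close>: the sum over \<open>p1\<close> is bounded by \<open>\<kappa>\<close> at every nonzero
  frequency, and Parseval's identity evaluates the second moment of the sum over \<open>p2\<close>.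
\<close>

lemma prime_triples_fourier_bound:
  assumes "prime q" "X < real q" "coprime a (int q)"
    and K: "\<And>b. \<not> int q dvd b \<Longrightarrow> norm (\<Sum>p\<in>primes_upto X. add_char q (b * mod_inv q p)) \<le> \<kappa>"
  shows "\<bar>real (card (prime_triples q a X)) - real (prime_pi X) ^ 3 / real q\<bar> \<le> \<kappa> * real (prime_pi X)"
proof -
  let ?P = "primes_upto X"
  have q: "q > 0" using prime_gt_0_nat[OF assms(1)] .
  have fin: "finite ?P" by (rule finite_primes_upto)
  have P: "p \<in> {1..<q}" if "p \<in> ?P" for p
    using that assms(2) prime_gt_0_nat[of p] by (auto simp: primes_upto_def)
  have a_nd: "\<not> int q dvd a"
    using assms(1,3) by (metis coprime_common_divisor dvd_refl not_prime_unit prime_nat_int_transfer)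
  define S where "S h = (\<Sum>p\<in>?P. add_char q (int h * int p))" for h
  define R where "R h = (\<Sum>p\<in>?P. add_char q ((- int h * a) * mod_inv q p))" for h
  have "complex_of_real (real q * real (card (prime_triples q a X))) =
      (\<Sum>t\<in>?P \<times> ?P \<times> ?P. if t \<in> prime_triples q a X then of_nat q else 0)"
  proof -
    have "(\<Sum>t\<in>?P \<times> ?P \<times> ?P. if t \<in> prime_triples q a X then of_nat q else (0::complex)) =
        (\<Sum>t\<in>(?P \<times> ?P \<times> ?P) \<inter> prime_triples q a X. of_nat q)"
      using fin by (subst sum.inter_restrict) auto
    also have "(?P \<times> ?P \<times> ?P) \<inter> prime_triples q a X = prime_triples q a X"
      by (auto simp: prime_triples_def)
    finally show ?thesis by simp
  qed
  also have "\<dots> = (\<Sum>(p1, p2, p3)\<in>?P \<times> ?P \<times> ?P. \<Sum>h<q. add_char q (int h * (int p2 + int p3 - a * mod_inv q p1)))"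
  proof (intro sum.cong refl, clarify)
    fix p1 p2 p3 assume p: "p1 \<in> ?P" "p2 \<in> ?P" "p3 \<in> ?P"
    have nd: "\<not> q dvd p1" using P[OF p(1)] by (auto dest: dvd_imp_le)
    note inv = mod_inv_correct[OF assms(1) nd]
    have "[int p1 * (int p2 + int p3) = a] (mod int q) \<longleftrightarrow> [int p2 + int p3 = a * mod_inv q p1] (mod int q)"
    proof
      assume "[int p1 * (int p2 + int p3) = a] (mod int q)"
      then have "[int p1 * (int p2 + int p3) * mod_inv q p1 = a * mod_inv q p1] (mod int q)"
        by (rule cong_scalar_right)
      moreover have "[(int p2 + int p3) * (int p1 * mod_inv q p1) = (int p2 + int p3) * 1] (mod int q)"
        by (rule cong_scalar_left[OF inv])
      moreover have "(int p2 + int p3) * (int p1 * mod_inv q p1) = int p1 * (int p2 + int p3) * mod_inv q p1"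
        by (simp only: mult_ac)
      ultimately show "[int p2 + int p3 = a * mod_inv q p1] (mod int q)"
        by (metis cong_sym cong_trans mult.right_neutral)
    next
      assume "[int p2 + int p3 = a * mod_inv q p1] (mod int q)"
      then have "[int p1 * (int p2 + int p3) = int p1 * (a * mod_inv q p1)] (mod int q)"
        by (rule cong_scalar_left)
      moreover have "int p1 * (a * mod_inv q p1) = a * (int p1 * mod_inv q p1)" by (simp only: mult_ac)
      moreover have "[a * (int p1 * mod_inv q p1) = a * 1] (mod int q)"
        by (rule cong_scalar_left[OF inv])
      ultimately show "[int p1 * (int p2 + int p3) = a] (mod int q)"
        by (metis cong_trans mult.right_neutral)
    qed
    then show "(if (p1, p2, p3) \<in> prime_triples q a X then of_nat q else 0) =
        (\<Sum>h<q. add_char q (int h * (int p2 + int p3 - a * mod_inv q p1)))"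
      using p by (simp add: prime_triples_def add_char_orthogonality[OF q] cong_iff_dvd_diff)
  qed
  also have "\<dots> = (\<Sum>h<q. \<Sum>(p1, p2, p3)\<in>?P \<times> ?P \<times> ?P. add_char q (int h * (int p2 + int p3 - a * mod_inv q p1)))"
    by (subst sum.swap) (simp add: case_prod_unfold)
  also have "\<dots> = (\<Sum>h<q. R h * S h ^ 2)"
  proof (intro sum.cong refl)
    fix h
    have S2: "S h ^ 2 = (\<Sum>p2\<in>?P. \<Sum>p3\<in>?P. add_char q (int h * int p2) * add_char q (int h * int p3))"
      by (simp add: S_def power2_eq_square sum_product)
    have "R h * S h ^ 2 = (\<Sum>p1\<in>?P. \<Sum>p2\<in>?P. \<Sum>p3\<in>?P.
        add_char q ((- int h * a) * mod_inv q p1) * (add_char q (int h * int p2) * add_char q (int h * int p3)))"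
      unfolding S2 R_def sum_distrib_right by (simp only: sum_distrib_left)
    also have "\<dots> = (\<Sum>p1\<in>?P. \<Sum>p2\<in>?P. \<Sum>p3\<in>?P. add_char q (int h * (int p2 + int p3 - a * mod_inv q p1)))"
      unfolding add_char_add[symmetric] by (intro sum.cong refl arg_cong[where f = "add_char q"]) (simp add: algebra_simps)
    finally show "(\<Sum>(p1, p2, p3)\<in>?P \<times> ?P \<times> ?P. add_char q (int h * (int p2 + int p3 - a * mod_inv q p1))) = R h * S h ^ 2"
      by (simp add: sum.cartesian_product)
  qed
  also have "{..<q} = insert 0 {1..<q}" using q by auto
  also have "(\<Sum>h\<in>insert 0 {1..<q}. R h * S h ^ 2) = R 0 * S 0 ^ 2 + (\<Sum>h = 1..<q. R h * S h ^ 2)"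
    by simp
  also have "R 0 * S 0 ^ 2 = complex_of_real (real (prime_pi X) ^ 3)"
    by (simp add: R_def S_def prime_pi_def power2_eq_square power3_eq_cube)
  finally have "complex_of_real (real q * real (card (prime_triples q a X)) - real (prime_pi X) ^ 3) = (\<Sum>h = 1..<q. R h * S h ^ 2)"
    by (simp add: of_real_diff algebra_simps)
  then have "\<bar>real q * real (card (prime_triples q a X)) - real (prime_pi X) ^ 3\<bar> = norm (\<Sum>h = 1..<q. R h * S h ^ 2)"
    by (metis norm_of_real)
  also have "\<dots> \<le> (\<Sum>h = 1..<q. \<kappa> * norm (S h) ^ 2)"
  proof (intro sum_norm_le)
    fix h assume h: "h \<in> {1..<q}"
    have "\<not> int q dvd int h" using h by (auto dest: dvd_imp_le)
    then have "\<not> int q dvd - int h * a"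
      using a_nd assms(1) by (simp add: prime_dvd_mult_iff)
    from K[OF this] show "norm (R h * S h ^ 2) \<le> \<kappa> * norm (S h) ^ 2"
      by (simp add: R_def norm_mult norm_power mult_right_mono)
  qed
  also have "\<dots> \<le> (\<Sum>h<q. \<kappa> * norm (S h) ^ 2)"
  proof (rule sum_mono2)
    have "0 \<le> norm (\<Sum>p\<in>?P. add_char q (1 * mod_inv q p))" by simp
    also have "\<dots> \<le> \<kappa>" using prime_gt_1_nat[OF assms(1)] by (intro K) auto
    finally show "0 \<le> \<kappa> * norm (S h) ^ 2" for h by simp
  qed auto
  also have "\<dots> = \<kappa> * (real q * real (prime_pi X))"
  proof -
    have "{(i, j). i \<in> ?P \<and> j \<in> ?P \<and> [int i = int j] (mod int q)} = (\<lambda>p. (p, p)) ` ?P"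
    proof (intro equalityI subsetI)
      fix t assume "t \<in> {(i, j). i \<in> ?P \<and> j \<in> ?P \<and> [int i = int j] (mod int q)}"
      then obtain i j where t: "t = (i, j)" "i \<in> ?P" "j \<in> ?P" "[int i = int j] (mod int q)"
        by auto
      from P[OF t(2)] P[OF t(3)] t(4) have "i = j" by (intro cong_nat_lt_eq) auto
      with t show "t \<in> (\<lambda>p. (p, p)) ` ?P" by auto
    qed auto
    then have "card {(i, j). i \<in> ?P \<and> j \<in> ?P \<and> [int i = int j] (mod int q)} = prime_pi X"
      by (simp add: prime_pi_def card_image inj_on_def)
    then show ?thesis
      unfolding S_def sum_distrib_left[symmetric] add_char_second_moment[OF q fin] by simp
  qed
  finally have main: "\<bar>real q * real (card (prime_triples q a X)) - real (prime_pi X) ^ 3\<bar> \<le> real q * (\<kappa> * real (prime_pi X))"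
    by (simp add: mult_ac)
  have "\<bar>real q * real (card (prime_triples q a X)) - real (prime_pi X) ^ 3\<bar> =
      real q * \<bar>real (card (prime_triples q a X)) - real (prime_pi X) ^ 3 / real q\<bar>"
  proof -
    have "real q * real (card (prime_triples q a X)) - real (prime_pi X) ^ 3 =
        real q * (real (card (prime_triples q a X)) - real (prime_pi X) ^ 3 / real q)"
      using q by (simp add: field_simps)
    then show ?thesis by (simp add: abs_mult)
  qed
  with main show ?thesis using q by (simp add: mult_le_cancel_left_pos)
qed

lemma prime_pi_le:
  assumes "X \<ge> 0"
  shows "real (prime_pi X) \<le> X"
proof -
  have "primes_upto X \<subseteq> {1..nat \<lfloor>X\<rfloor>}"
    by (auto simp: primes_upto_def le_nat_floor prime_gt_0_nat Suc_le_eq)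
  then have "prime_pi X \<le> nat \<lfloor>X\<rfloor>"
    unfolding prime_pi_def using card_mono[of "{1..nat \<lfloor>X\<rfloor>}"] by fastforce
  then have "real (prime_pi X) \<le> real (nat \<lfloor>X\<rfloor>)" by simp
  also have "\<dots> \<le> X" using assms by (simp add: of_nat_nat)
  finally show ?thesis .
qed

text \<open>
  The element \<open>p3\<close> is determined modulo \<open>q\<close> by \<open>p1\<close> and \<open>p2\<close>, and it is smaller than \<open>q\<close>.
\<close>

lemma card_prime_triples_le:
  assumes "prime q" "X < real q"
  shows "card (prime_triples q a X) \<le> prime_pi X ^ 2"
proof -
  let ?P = "primes_upto X"
  have P: "p \<in> {1..<q}" if "p \<in> ?P" for p
    using that assms(2) prime_gt_0_nat[of p] by (auto simp: primes_upto_def)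
  have "card (prime_triples q a X) \<le> card (?P \<times> ?P)"
  proof (rule card_inj_on_le)
    show "inj_on (\<lambda>(p1, p2, p3). (p1, p2)) (prime_triples q a X)"
    proof (rule inj_onI)
      fix s t assume st: "s \<in> prime_triples q a X" "t \<in> prime_triples q a X"
        "(\<lambda>(p1, p2, p3). (p1, p2)) s = (\<lambda>(p1, p2, p3). (p1, p2)) t"
      obtain x y z z' where s: "s = (x, y, z)" and t: "t = (x, y, z')"
        using st(3) by (cases s, cases t) auto
      have x: "x \<in> ?P" "z \<in> ?P" "z' \<in> ?P"
        and c: "[int x * (int y + int z) = a] (mod int q)" "[int x * (int y + int z') = a] (mod int q)"
        using st(1,2) by (auto simp: s t prime_triples_def)
      have "\<not> int q dvd int x" using P[OF x(1)] by (auto dest: dvd_imp_le)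
      then have cop: "coprime (int x) (int q)" by (rule coprime_prime_modulus[OF assms(1)])
      have "[int x * (int y + int z) = int x * (int y + int z')] (mod int q)"
        by (rule cong_trans[OF c(1) cong_sym[OF c(2)]])
      then have "[int z = int z'] (mod int q)"
        by (simp only: cong_mult_lcancel[OF cop] cong_add_lcancel)
      then have "z = z'" using P[OF x(2)] P[OF x(3)] by (intro cong_nat_lt_eq) auto
      then show "s = t" by (simp add: s t)
    qed
  qed (auto simp: prime_triples_def finite_primes_upto)
  then show ?thesis by (simp add: prime_pi_def card_cartesian_product power2_eq_square)
qed

lemma prime_triples_trivial_bound:
  assumes "prime q" "0 < X" "X < real q"
  shows "\<bar>real (card (prime_triples q a X)) - real (prime_pi X) ^ 3 / real q\<bar> \<le> X ^ 2"
proof -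
  have pi: "real (prime_pi X) \<le> X" using assms prime_pi_le by simp
  have "real (card (prime_triples q a X)) \<le> real (prime_pi X ^ 2)"
    using card_prime_triples_le[OF assms(1,3)] by (simp only: of_nat_le_iff)
  also have "\<dots> \<le> X ^ 2" using pi by (simp add: power_mono)
  finally have 1: "real (card (prime_triples q a X)) \<le> X ^ 2" .
  have "real (prime_pi X) ^ 3 / real q \<le> X ^ 3 / X"
    using pi assms by (intro frac_le power_mono) auto
  also have "\<dots> = X ^ 2" using assms by (simp add: power2_eq_square power3_eq_cube)
  finally have 2: "real (prime_pi X) ^ 3 / real q \<le> X ^ 2" .
  have "0 \<le> real (prime_pi X) ^ 3 / real q" by simp
  with 1 2 show ?thesis by linarith
qed

text \<open>
  This makes \<open>C * q powr \<delta>\<close> an admissible value of the parameter \<open>L\<close>.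
\<close>

lemma log_and_divisor_bound:
  assumes "(\<delta>::real) > 0"
  obtains C where "\<And>q::nat. q \<ge> 1 \<Longrightarrow> 2 + ln (real q) \<le> C * real q powr \<delta>"
    "\<And>q n::nat. q \<ge> 1 \<Longrightarrow> 0 < n \<Longrightarrow> n \<le> 9 * q ^ 2 \<Longrightarrow> real (card {d. d dvd n}) \<le> C * real q powr \<delta>"
proof -
  obtain D where D: "\<And>n::nat. n > 0 \<Longrightarrow> real (card {d. d dvd n}) \<le> D * real n powr (\<delta> / 2)"
    using divisor_bound[of "\<delta> / 2"] assms by auto
  have "1 \<le> D" using D[of 1] by simp
  define C where "C = max (2 + 1 / \<delta>) (D * 9 powr (\<delta> / 2))"
  have log: "2 + ln (real q) \<le> C * real q powr \<delta>" if "q \<ge> 1" for q :: nat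
  proof -
    have q1: "1 \<le> real q powr \<delta>" using that assms by (intro ge_one_powr_ge_zero) auto
    have "ln (real q) \<le> real q powr \<delta> / \<delta>"
      using that assms by (intro ln_powr_bound) auto
    then have "2 + ln (real q) \<le> (2 + 1 / \<delta>) * real q powr \<delta>"
      using q1 by (simp add: distrib_right)
    also have "\<dots> \<le> C * real q powr \<delta>" by (intro mult_right_mono) (auto simp: C_def)
    finally show ?thesis .
  qed
  have div: "real (card {d. d dvd n}) \<le> C * real q powr \<delta>" if "q \<ge> 1" "0 < n" "n \<le> 9 * q ^ 2" for q n :: nat
  proof -
    have "real n \<le> real (9 * q ^ 2)" using that(3) by (simp only: of_nat_le_iff)
    then have nq: "real n \<le> 9 * real q ^ 2" by simp
    have "real (card {d. d dvd n}) \<le> D * real n powr (\<delta> / 2)" by (rule D[OF that(2)])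
    also have "\<dots> \<le> D * (9 * real q ^ 2) powr (\<delta> / 2)"
      using nq \<open>1 \<le> D\<close> assms by (intro mult_left_mono powr_mono2) auto
    also have "\<dots> = D * 9 powr (\<delta> / 2) * real q powr \<delta>"
      using that by (simp add: powr_mult powr_powr flip: powr_numeral)
    also have "\<dots> \<le> C * real q powr \<delta>" by (intro mult_right_mono) (auto simp: C_def)
    finally show ?thesis .
  qed
  show thesis using log div by (rule that)
qed

theorem theorem4:
  shows "\<forall>\<epsilon>::real. \<epsilon> > 0 \<longrightarrow> (\<exists>C::real. \<forall>(q::nat) (X::real) (a::int).
           prime q \<and> 0 < X \<and> X < real q \<and> coprime a (int q) \<longrightarrow>
           \<bar>real (card (prime_triples q a X)) - real (prime_pi X) ^ 3 / real q\<bar>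
             \<le> C * real q powr (3 / 16 + \<epsilon>) * X powr (57 / 32))"
proof (intro allI impI)
  fix \<epsilon> :: real assume eps: "\<epsilon> > 0"
  obtain C where C: "\<And>q::nat. q \<ge> 1 \<Longrightarrow> 2 + ln (real q) \<le> C * real q powr (\<epsilon> / 5)"
    "\<And>q n::nat. q \<ge> 1 \<Longrightarrow> 0 < n \<Longrightarrow> n \<le> 9 * q ^ 2 \<Longrightarrow> real (card {d. d dvd n}) \<le> C * real q powr (\<epsilon> / 5)"
    using log_and_divisor_bound[of "\<epsilon> / 5"] eps by auto
  have C2: "2 \<le> C" using C(1)[of 1] by simp
  show "\<exists>C::real. \<forall>(q::nat) (X::real) (a::int).
           prime q \<and> 0 < X \<and> X < real q \<and> coprime a (int q) \<longrightarrow>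
           \<bar>real (card (prime_triples q a X)) - real (prime_pi X) ^ 3 / real q\<bar>
             \<le> C * real q powr (3 / 16 + \<epsilon>) * X powr (57 / 32)"
  proof (intro exI[of _ "58 * C ^ 5"] allI impI)
    fix q :: nat and X :: real and a :: int
    assume "prime q \<and> 0 < X \<and> X < real q \<and> coprime a (int q)"
    then have q: "prime q" and X: "0 < X" "X < real q" and a: "coprime a (int q)" by auto
    have q1: "q > 1" using prime_gt_1_nat[OF q] .
    let ?err = "\<bar>real (card (prime_triples q a X)) - real (prime_pi X) ^ 3 / real q\<bar>"
    show "?err \<le> 58 * C ^ 5 * real q powr (3 / 16 + \<epsilon>) * X powr (57 / 32)"
    proof (cases "1 \<le> X powr (5 / 6) * real q powr (- 2 / 3)")
      case True
      define L where "L = C * real q powr (\<epsilon> / 5)"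
      have "?err \<le> 58 * L ^ 5 * (X powr (25 / 32) * real q powr (3 / 16)) * real (prime_pi X)"
      proof (rule prime_triples_fourier_bound[OF q X(2) a])
        fix b assume "\<not> int q dvd b"
        then interpret prime_kloosterman q b X L
          using q X True C q1 by unfold_locales (auto simp: L_def)
        show "norm (\<Sum>p\<in>primes_upto X. add_char q (b * mod_inv q p)) \<le>
            58 * L ^ 5 * (X powr (25 / 32) * real q powr (3 / 16))"
          using prime_sum_bound by (simp add: F_def Q_def)
      qed
      also have "\<dots> \<le> 58 * L ^ 5 * (X powr (25 / 32) * real q powr (3 / 16)) * X powr 1"
        using X C2 prime_pi_le[of X] by (intro mult_left_mono) (auto simp: L_def)
      also have "\<dots> = 58 * L ^ 5 * real q powr (3 / 16) * (X powr (25 / 32) * X powr 1)"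
        by (simp only: mult_ac)
      also have "X powr (25 / 32) * X powr 1 = X powr (57 / 32)"
        unfolding powr_add[symmetric] by simp
      also have "L ^ 5 = C ^ 5 * real q powr \<epsilon>"
        using q1 by (simp add: L_def power_mult_distrib powr_power)
      also have "58 * (C ^ 5 * real q powr \<epsilon>) * real q powr (3 / 16) * X powr (57 / 32) =
          58 * C ^ 5 * real q powr (3 / 16 + \<epsilon>) * X powr (57 / 32)"
        by (simp add: powr_add mult_ac)
      finally show ?thesis .
    next
      case False
      \<comment> \<open>This is the condition for the trivial bound \<open>X^2\<close> to be small enough. Here
        \<open>X < q^(4/5)\<close>, and \<open>7/32\<close> is \<open>5/6\<close> times \<open>21/80\<close>.\<close>
      have "X powr (7 / 32) \<le> real q powr (3 / 16)"
      proof -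
        have "X powr (5 / 6) * real q powr (- 2 / 3) * real q powr (2 / 3) \<le> 1 * real q powr (2 / 3)"
          using False by (intro mult_right_mono) auto
        then have "X powr (5 / 6) \<le> real q powr (2 / 3)"
          using q1 by (simp add: mult.assoc powr_add[symmetric])
        then have "(X powr (5 / 6)) powr (21 / 80) \<le> (real q powr (2 / 3)) powr (21 / 80)"
          by (intro powr_mono2) auto
        then have "X powr (7 / 32) \<le> real q powr (7 / 40)" by (simp add: powr_powr)
        also have "\<dots> \<le> real q powr (3 / 16)" using q1 by (intro powr_mono) auto
        finally show ?thesis .
      qed
      have "?err \<le> X powr 2"
        using prime_triples_trivial_bound[OF q X] X by simp
      also have "X powr 2 = X powr (7 / 32) * X powr (57 / 32)"
        unfolding powr_add[symmetric] by simp
      also have "\<dots> \<le> real q powr (3 / 16) * X powr (57 / 32)"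
        using \<open>X powr (7 / 32) \<le> real q powr (3 / 16)\<close> by (intro mult_right_mono) auto
      also have "\<dots> \<le> (58 * C ^ 5 * real q powr (3 / 16 + \<epsilon>)) * X powr (57 / 32)"
      proof (rule mult_right_mono)
        have "real q powr (3 / 16) \<le> real q powr (3 / 16 + \<epsilon>)"
          using q1 eps by (intro powr_mono) auto
        then have "real q powr (3 / 16) \<le> 1 * real q powr (3 / 16 + \<epsilon>)" by simp
        also have "\<dots> \<le> 58 * C ^ 5 * real q powr (3 / 16 + \<epsilon>)"
        proof (rule mult_right_mono)
          have "1 \<le> C ^ 5" using C2 by (intro one_le_power) auto
          then show "1 \<le> 58 * C ^ 5" by simp
        qed simp
        finally show "real q powr (3 / 16) \<le> 58 * C ^ 5 * real q powr (3 / 16 + \<epsilon>)" .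
      qed simp
      finally show ?thesis by (simp add: mult_ac)
    qed
  qed
qed

end
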